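(* Suppose that the initial finite element data satisfy Gauss' law, i.e. $(\mathbf E_h^0,\nabla_{\mathbf x}\phi_i)=-(\epsilon_0^{-1}\rho_h^0,\phi_i)$ for all $i\in\mathcal I_{\mathbf x}$ and $\nabla_{\mathbf x}\cdot\mathbf B_h^0=0$ a.e., and suppose that the discrete continuity equation $$\big(\nabla_{\mathbf x}\cdot(\mathbf J_h^n-\mathsf A_{\mathbf x}^n\nabla_{\mathbf x}\rho_h^n),\phi_i\big)=-\Big(\frac{\rho_h^{n+1}-\rho_h^n}{\tau_n},\phi_i\Big)\qquad\forall i\in\mathcal I_{\mathbf x}$$ holds for all time steps $n\ge 0$. Let $\mathbf E_h^{n+1}\in\boldsymbol{\mathbb E}$ and $\mathbf B_h^{n+1}\in\boldsymbol{\mathbb B}$, $n\ge 0$, be the finite element solutions of the forward Euler scheme $$\Big(\frac{\mathbf E_h^{n+1}-\mathbf E_h^n}{\tau_n},\boldsymbol\eta\Big)=\big(c^2\mathbf B_h^n,\nabla_{\mathbf x}\times\boldsymbol\eta\big)-\big(\epsilon_0^{-1}(\mathbf J_h^n-\mathsf A_{\mathbf x}^n\nabla_{\mathbf x}\rho_h^n),\boldsymbol\eta\big)\qquad\forall\boldsymbol\eta\in\boldsymbol{\mathbb E},$$ $$\Big(\frac{\mathbf B_h^{n+1}-\mathbf B_h^n}{\tau_n},\boldsymbol\xi\Big)=\big(-\nabla_{\mathbf x}\times\mathbf E_h^n,\boldsymbol\xi\big)\qquad\forall\boldsymbol\xi\in\boldsymbol{\mathbb B}.$$ Then Gauss' law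 holds weakly: for every $n\ge 0$, $$\Big(\frac{\mathbf E_h^{n+1}-\mathbf E_h^n}{\tau_n},\nabla_{\mathbf x}\phi_i\Big)=-\Big(\epsilon_0^{-1}\frac{\rho_h^{n+1}-\rho_h^n}{\tau_n},\phi_i\Big)\quad\forall i\in\mathcal I_{\mathbf x},\qquad\text{and}\qquad \nabla_{\mathbf x}\cdot\mathbf B_h^{n+1}=0\ \text{ a.e.}$$
   Context: Let $\Omega_{\mathbf x}\subset\mathbb R^{3}$ be a box with periodic boundary conditions, partitioned by a conforming Cartesian mesh $\mathcal T_{\mathbf x}$ into axis-parallel cuboids $K$, each the image of a reference cuboid $\widehat K$ under an affine map $\mathbf T_K$. Fix an integer $k\ge1$. $(\cdot,\cdot)$ denotes the $L^2(\Omega_{\mathbf x})$ inner product (of scalars or vectors). All finite element spaces below are understood with periodic boundary conditions. $\mathbb Q_{a_1,a_2,a_3}$ denotes polynomials in three variables of degree at most $a_l$ in the $l$-th variable, and $\mathbb Q_k=\mathbb Q_{k,k,k}$. The scalar space is $\mathbb V_{\mathbf x}=\{w\in C^0(\overline\Omega_{\mathbf x}): w\circ\mathbf T_K\in\mathbb Q_k(\widehat K)\ \forall K\in\mathcal T_{\mathbf x}\}$ with Lagrange basis $\{\phi_i\}_{i\in\mathcal I_{\mathbf x}}$. Define $$\mathcal N_{k-1}=[\mathbb Q_{k-1,k,k},\mathbb Q_{k,k-1,k},\mathbb Q_{k,k,k-1}],\qquad \mathcal{RT}_{k-1}=[\mathbb Q_{k,k-1,k-1},\mathbb Q_{k-1,k,k-1},\mathbb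 Q_{k-1,k-1,k}]$$ (Nédélec and Raviart–Thomas elements on $\widehat K$), and $$\boldsymbol{\mathbb E}=\{\mathbf w\in\mathbf H(\mathrm{curl};\Omega_{\mathbf x}): [\nabla_{\widehat{\mathbf x}}\mathbf T_K]^\top\,\mathbf w\circ\mathbf T_K\in\mathcal N_{k-1}(\widehat K)\ \forall K\},$$ $$\boldsymbol{\mathbb B}=\{\mathbf w\in\mathbf H(\mathrm{div};\Omega_{\mathbf x}): \det(\nabla_{\widehat{\mathbf x}}\mathbf T_K)[\nabla_{\widehat{\mathbf x}}\mathbf T_K]^{-1}\,\mathbf w\circ\mathbf T_K\in\mathcal{RT}_{k-1}(\widehat K)\ \forall K\}.$$ The constants $\epsilon_0,\mu_0>0$ are given, $c=1/\sqrt{\epsilon_0\mu_0}$, and $\tau_n>0$ are the time steps. For each $n\ge0$, $\rho_h^n\in\mathbb V_{\mathbf x}$ (charge density), $\mathbf J_h^n\in[\mathbb V_{\mathbf x}]^3$ (current density) and the diagonal viscosity matrix $\mathsf A_{\mathbf x}^n$ with diagonal entries in $\mathbb V_{\mathbf x}$ are given; $\mathbf E_h^0\in\boldsymbol{\mathbb E}$ and $\mathbf B_h^0\in\boldsymbol{\mathbb B}$ are the initial fields. Since $\mathbf J_h^n-\mathsf A_{\mathbf x}^n\nabla_{\mathbf x}\rho_h^n$ need not be in $\mathbf H(\mathrm{div})$, the pairing $(\nabla_{\mathbf x}\cdot\mathbf G,\phi_i)$ in the discrete continuity equation is understood in the weak sense, $(\nabla_{\mathbf x}\cdot\mathbf G,\phi_i):=-(\mathbf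 G,\nabla_{\mathbf x}\phi_i)$. *)

theory Defs
  imports "HOL-Analysis.Analysis"
begin

section \<open>Smooth periodic test functions\<close>

definition partial :: "3 \<Rightarrow> (real^3 \<Rightarrow> real) \<Rightarrow> real^3 \<Rightarrow> real" where
  "partial l f x = frechet_derivative f (at x) (axis l 1)"

primrec Ck :: "nat \<Rightarrow> (real^3 \<Rightarrow> real) \<Rightarrow> bool" where
  "Ck 0 f \<longleftrightarrow> continuous_on UNIV f"
| "Ck (Suc n) f \<longleftrightarrow> (\<forall>x. f differentiable at x) \<and> (\<forall>l. Ck n (partial l f))"

text \<open>
  The periodic box is represented by its corners \<open>a\<close> and \<open>b\<close>, the domain being \<open>box a b\<close>.
  Test functions live on all of \<open>\<real>\<^sup>3\<close> and are periodic with respect to the lattice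
  generated by the edges of the box, i.e. they are the smooth functions on the torus.
\<close>

definition test_scalar :: "real^3 \<Rightarrow> real^3 \<Rightarrow> (real^3 \<Rightarrow> real) set" where
  "test_scalar a b =
     {\<psi>. (\<forall>n. Ck n \<psi>) \<and> (\<forall>x l. \<psi> (x + (b $ l - a $ l) *\<^sub>R axis l 1) = \<psi> x)}"

definition test_vector :: "real^3 \<Rightarrow> real^3 \<Rightarrow> (real^3 \<Rightarrow> real^3) set" where
  "test_vector a b = {\<psi>. \<forall>l. (\<lambda>x. \<psi> x $ l) \<in> test_scalar a b}"

definition classical_grad :: "(real^3 \<Rightarrow> real) \<Rightarrow> real^3 \<Rightarrow> real^3" where
  "classical_grad f x = (\<chi> l. partial l f x)"

definition classical_div :: "(real^3 \<Rightarrow> real^3) \<Rightarrow> real^3 \<Rightarrow> real" where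
  "classical_div f x = (\<Sum>l\<in>UNIV. partial l (\<lambda>y. f y $ l) x)"

definition classical_curl :: "(real^3 \<Rightarrow> real^3) \<Rightarrow> real^3 \<Rightarrow> real^3" where
  "classical_curl f x = vector
     [partial 2 (\<lambda>y. f y $ 3) x - partial 3 (\<lambda>y. f y $ 2) x,
      partial 3 (\<lambda>y. f y $ 1) x - partial 1 (\<lambda>y. f y $ 3) x,
      partial 1 (\<lambda>y. f y $ 2) x - partial 2 (\<lambda>y. f y $ 1) x]"


section \<open>Square-integrable functions and weak derivatives on the periodic box\<close>

text \<open>
  Elements of \<open>L\<^sup>2\<close> and of the spaces built on it are represented by functions rather than
  by classes of functions that agree almost everywhere; values outside the box are irrelevant.
\<close>

definition L2 :: "real^3 \<Rightarrow> real^3 \<Rightarrow> (real^3 \<Rightarrow> 'v::euclidean_space) set" where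
  "L2 a b = {f. f \<in> borel_measurable (lebesgue_on (box a b)) \<and>
                integrable (lebesgue_on (box a b)) (\<lambda>x. (norm (f x))\<^sup>2)}"

definition L2_inner ::
  "real^3 \<Rightarrow> real^3 \<Rightarrow> (real^3 \<Rightarrow> 'v::euclidean_space) \<Rightarrow> (real^3 \<Rightarrow> 'v) \<Rightarrow> real" where
  "L2_inner a b f g = (LINT x|lebesgue_on (box a b). f x \<bullet> g x)"

text \<open>
  Testing against periodic functions, which need not vanish on the boundary of the box, builds
  the periodic boundary conditions into the weak derivatives.
\<close>

definition has_weak_grad ::
  "real^3 \<Rightarrow> real^3 \<Rightarrow> (real^3 \<Rightarrow> real) \<Rightarrow> (real^3 \<Rightarrow> real^3) \<Rightarrow> bool" where
  "has_weak_grad a b w g \<longleftrightarrow> g \<in> L2 a b \<and>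
     (\<forall>\<psi>\<in>test_vector a b. L2_inner a b w (classical_div \<psi>) = - L2_inner a b g \<psi>)"

definition has_weak_curl ::
  "real^3 \<Rightarrow> real^3 \<Rightarrow> (real^3 \<Rightarrow> real^3) \<Rightarrow> (real^3 \<Rightarrow> real^3) \<Rightarrow> bool" where
  "has_weak_curl a b w c \<longleftrightarrow> c \<in> L2 a b \<and>
     (\<forall>\<psi>\<in>test_vector a b. L2_inner a b w (classical_curl \<psi>) = L2_inner a b c \<psi>)"

definition has_weak_div ::
  "real^3 \<Rightarrow> real^3 \<Rightarrow> (real^3 \<Rightarrow> real^3) \<Rightarrow> (real^3 \<Rightarrow> real) \<Rightarrow> bool" where
  "has_weak_div a b w d \<longleftrightarrow> d \<in> L2 a b \<and>
     (\<forall>\<psi>\<in>test_scalar a b. L2_inner a b w (classical_grad \<psi>) = - L2_inner a b d \<psi>)"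

text \<open>Weak derivatives are unique up to null sets; the operators pick a representative.\<close>

definition grad :: "real^3 \<Rightarrow> real^3 \<Rightarrow> (real^3 \<Rightarrow> real) \<Rightarrow> real^3 \<Rightarrow> real^3" where
  "grad a b w = (SOME g. has_weak_grad a b w g)"

definition curl :: "real^3 \<Rightarrow> real^3 \<Rightarrow> (real^3 \<Rightarrow> real^3) \<Rightarrow> real^3 \<Rightarrow> real^3" where
  "curl a b w = (SOME c. has_weak_curl a b w c)"

definition diverg :: "real^3 \<Rightarrow> real^3 \<Rightarrow> (real^3 \<Rightarrow> real^3) \<Rightarrow> real^3 \<Rightarrow> real" where
  "diverg a b w = (SOME d. has_weak_div a b w d)"

definition H_curl :: "real^3 \<Rightarrow> real^3 \<Rightarrow> (real^3 \<Rightarrow> real^3) set" where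
  "H_curl a b = {w \<in> L2 a b. \<exists>c. has_weak_curl a b w c}"

definition H_div :: "real^3 \<Rightarrow> real^3 \<Rightarrow> (real^3 \<Rightarrow> real^3) set" where
  "H_div a b = {w \<in> L2 a b. \<exists>d. has_weak_div a b w d}"

text \<open>
  The pairing \<open>(\<nabla>\<cdot>G, \<phi>)\<close> for square-integrable \<open>G\<close> that need not lie in \<open>H_div\<close>.
\<close>

definition div_pairing ::
  "real^3 \<Rightarrow> real^3 \<Rightarrow> (real^3 \<Rightarrow> real^3) \<Rightarrow> (real^3 \<Rightarrow> real) \<Rightarrow> real" where
  "div_pairing a b G \<phi> = - L2_inner a b G (grad a b \<phi>)"


section \<open>Conforming Cartesian meshes\<close>

definition conforming_mesh :: "real^3 \<Rightarrow> real^3 \<Rightarrow> (real^3) set set \<Rightarrow> bool" where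
  "conforming_mesh a b T \<longleftrightarrow>
     T division_of cbox a b \<and>
     (\<forall>K\<in>T. interior K \<noteq> {}) \<and>
     (\<forall>K\<in>T. \<forall>L\<in>T. (K \<inter> L) face_of K \<and> (K \<inter> L) face_of L)"

definition ref_cell :: "(real^3) set" where
  "ref_cell = cbox 0 1"

definition cell_width :: "(real^3) set \<Rightarrow> real^3" where
  "cell_width K = interval_upperbound K - interval_lowerbound K"

text \<open>The affine map from the reference cell onto \<open>K\<close> and its (constant) Jacobian matrix.\<close>

definition cell_map :: "(real^3) set \<Rightarrow> real^3 \<Rightarrow> real^3" where
  "cell_map K x = (\<chi> l. interval_lowerbound K $ l + cell_width K $ l * x $ l)"

definition cell_jacobian :: "(real^3) set \<Rightarrow> real^3^3" where
  "cell_jacobian K = (\<chi> i j. if i = j then cell_width K $ i else 0)"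

lemma cell_map_has_derivative:
  "(cell_map K has_derivative (*v) (cell_jacobian K)) (at x)"
proof -
  have eq: "cell_map K = (\<lambda>y. interval_lowerbound K + cell_jacobian K *v y)"
    by (auto simp: fun_eq_iff vec_eq_iff cell_map_def cell_jacobian_def
        matrix_vector_mult_def if_distrib if_distribR cong: if_cong)
  have "((\<lambda>y. cell_jacobian K *v y) has_derivative (*v) (cell_jacobian K)) (at x)"
    by (rule bounded_linear_imp_has_derivative)
       (simp add: linear_conv_bounded_linear[symmetric])
  then show ?thesis
    unfolding eq by (auto intro!: derivative_eq_intros)
qed

lemma cell_map_image:
  assumes "conforming_mesh a b T" "K \<in> T"
  shows "cell_map K ` ref_cell = K"
proof -
  have "T division_of cbox a b" and int: "interior K \<noteq> {}"
    using assms by (simp_all add: conforming_mesh_def)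
  then obtain u v where K: "K = cbox u v"
    using division_ofD(4) assms(2) by metis
  have "box u v \<noteq> {}"
    using int unfolding K by (simp only: interior_cbox not_False_eq_True)
  then have less: "u $ l < v $ l" for l
    by (metis interval_ne_empty_cart(2))
  then have "cbox u v \<noteq> {}"
    by (simp add: interval_ne_empty_cart(1) less_imp_le)
  then have ub: "interval_upperbound K = v" and lb: "interval_lowerbound K = u"
    unfolding K by (rule interval_bounds')+
  have map: "cell_map K x $ l = u $ l + (v $ l - u $ l) * x $ l" for x l
    by (simp add: cell_map_def cell_width_def ub lb)
  show ?thesis
  proof (intro subset_antisym subsetI)
    fix y assume "y \<in> cell_map K ` ref_cell"
    then obtain x where x: "x \<in> ref_cell" and y: "y = cell_map K x" by auto
    have "u $ l \<le> y $ l \<and> y $ l \<le> v $ l" for l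
    proof -
      have "0 \<le> x $ l" "x $ l \<le> 1"
        using x by (simp_all add: ref_cell_def mem_box_cart)
      then have "0 \<le> (v $ l - u $ l) * x $ l" "(v $ l - u $ l) * x $ l \<le> (v $ l - u $ l) * 1"
        using less[of l] by (intro mult_nonneg_nonneg mult_left_mono; simp)+
      then show ?thesis by (simp add: y map)
    qed
    then show "y \<in> K" by (simp add: K mem_box_cart)
  next
    fix y assume "y \<in> K"
    then have y: "u $ l \<le> y $ l" "y $ l \<le> v $ l" for l
      by (simp_all add: K mem_box_cart)
    define x :: "real^3" where "x = (\<chi> l. (y $ l - u $ l) / (v $ l - u $ l))"
    have "x \<in> ref_cell"
      using y less by (simp add: ref_cell_def mem_box_cart x_def divide_simps)
    moreover have "(v $ l - u $ l) * ((y $ l - u $ l) / (v $ l - u $ l)) = y $ l - u $ l" for l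
      using less[of l] by simp
    then have "y = cell_map K x"
      by (simp add: vec_eq_iff map x_def)
    ultimately show "y \<in> cell_map K ` ref_cell" by blast
  qed
qed


section \<open>Finite element spaces\<close>

definition Q_poly :: "nat \<Rightarrow> nat \<Rightarrow> nat \<Rightarrow> (real^3 \<Rightarrow> real) set" where
  "Q_poly d1 d2 d3 = {p. \<exists>c :: nat \<Rightarrow> nat \<Rightarrow> nat \<Rightarrow> real. \<forall>x.
     p x = (\<Sum>i\<le>d1. \<Sum>j\<le>d2. \<Sum>m\<le>d3. c i j m * (x $ 1)^i * (x $ 2)^j * (x $ 3)^m)}"

text \<open>
  The argument \<open>k\<close> is the degree of the scalar space, so \<open>Nedelec_poly k\<close> and
  \<open>RT_poly k\<close> are the spaces of order \<open>k - 1\<close> (for \<open>k \<ge> 1\<close>).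
\<close>

definition Nedelec_poly :: "nat \<Rightarrow> (real^3 \<Rightarrow> real^3) set" where
  "Nedelec_poly k = {p. (\<lambda>x. p x $ 1) \<in> Q_poly (k - 1) k k \<and>
                        (\<lambda>x. p x $ 2) \<in> Q_poly k (k - 1) k \<and>
                        (\<lambda>x. p x $ 3) \<in> Q_poly k k (k - 1)}"

definition RT_poly :: "nat \<Rightarrow> (real^3 \<Rightarrow> real^3) set" where
  "RT_poly k = {p. (\<lambda>x. p x $ 1) \<in> Q_poly k (k - 1) (k - 1) \<and>
                   (\<lambda>x. p x $ 2) \<in> Q_poly (k - 1) k (k - 1) \<and>
                   (\<lambda>x. p x $ 3) \<in> Q_poly (k - 1) (k - 1) k}"

definition V_space :: "real^3 \<Rightarrow> real^3 \<Rightarrow> (real^3) set set \<Rightarrow> nat \<Rightarrow> (real^3 \<Rightarrow> real) set" where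
  "V_space a b T k = {w.
     continuous_on (cbox a b) w \<and>
     (\<forall>l. \<forall>x\<in>cbox a b. x $ l = a $ l \<longrightarrow> w (x + (b $ l - a $ l) *\<^sub>R axis l 1) = w x) \<and>
     (\<forall>K\<in>T. \<exists>p\<in>Q_poly k k k. \<forall>x\<in>ref_cell. w (cell_map K x) = p x)}"

definition E_space :: "real^3 \<Rightarrow> real^3 \<Rightarrow> (real^3) set set \<Rightarrow> nat \<Rightarrow> (real^3 \<Rightarrow> real^3) set" where
  "E_space a b T k = {w \<in> H_curl a b. \<forall>K\<in>T. \<exists>p\<in>Nedelec_poly k.
     AE x in lebesgue_on ref_cell. transpose (cell_jacobian K) *v w (cell_map K x) = p x}"

definition B_space :: "real^3 \<Rightarrow> real^3 \<Rightarrow> (real^3) set set \<Rightarrow> nat \<Rightarrow> (real^3 \<Rightarrow> real^3) set" where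
  "B_space a b T k = {w \<in> H_div a b. \<forall>K\<in>T. \<exists>p\<in>RT_poly k.
     AE x in lebesgue_on ref_cell.
       det (cell_jacobian K) *\<^sub>R (matrix_inv (cell_jacobian K) *v w (cell_map K x)) = p x}"

text \<open>
  Lagrange nodes: the tensor product of one-dimensional nodes
  \<open>0 = \<theta> 0 < \<dots> < \<theta> k = 1\<close> (equispaced, Gauss--Lobatto, \dots) mapped to each
  cell.  Restricting to the half-open box picks one representative of each periodic orbit.
\<close>

definition lagrange_nodes ::
  "real^3 \<Rightarrow> real^3 \<Rightarrow> (real^3) set set \<Rightarrow> nat \<Rightarrow> (nat \<Rightarrow> real) \<Rightarrow> (real^3) set" where
  "lagrange_nodes a b T k \<theta> =
     {cell_map K (\<chi> l. \<theta> (\<alpha> l)) | K \<alpha>. K \<in> T \<and> (\<forall>l. \<alpha> l \<le> k)}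
     \<inter> {x. \<forall>l. a $ l \<le> x $ l \<and> x $ l < b $ l}"

definition lagrange_basis ::
  "real^3 \<Rightarrow> real^3 \<Rightarrow> (real^3) set set \<Rightarrow> nat \<Rightarrow> 'i set \<Rightarrow> ('i \<Rightarrow> real^3 \<Rightarrow> real) \<Rightarrow> bool" where
  "lagrange_basis a b T k I \<phi> \<longleftrightarrow> (\<exists>\<theta> nd.
     strict_mono_on {..k} \<theta> \<and> \<theta> 0 = 0 \<and> \<theta> k = 1 \<and>
     bij_betw nd I (lagrange_nodes a b T k \<theta>) \<and>
     (\<forall>i\<in>I. \<phi> i \<in> V_space a b T k \<and> (\<forall>j\<in>I. \<phi> i (nd j) = (if i = j then 1 else 0))))"

end

theory Submission
  imports Defs
begin

text \<open>
  The discrete Gauss laws hold because the finite element spaces form a complex: the gradient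
  maps the scalar space into the Nedelec space, the curl maps the Nedelec space into the
  Raviart--Thomas space, and two consecutive operators compose to zero. For the electric field,
  \<open>\<nabla>\<phi>\<^sub>i\<close> is therefore an admissible test function (\<open>grad_V_space\<close>); its curl vanishes
  almost everywhere, so only the current term of the scheme survives, and the discrete
  continuity equation turns it into the increment of the charge. For the magnetic field, the
  curl of the electric field lies in the space of the magnetic field (\<open>curl_E_space\<close>), so the
  weak update can be tested with its own residual and holds almost everywhere. A curl is
  orthogonal to all gradients of test functions, hence the update does not change the weak
  divergence (\<open>diverg_magnetic_update\<close>).

  The work lies in the two inclusions. Weak derivatives are chosen representatives, so they are
  first shown to be unique almost everywhere. This is the fundamental lemma of the calculus of
  variations for periodic test functions (\<open>fundamental_lemma_on_subbox\<close>), which needs smooth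
  periodic bumps; it is stated for test functions vanishing off a subbox so that it also
  identifies a weak derivative within one mesh cell. The gradient of a scalar
  element is then computed globally: along a line parallel to an axis a continuous piecewise
  polynomial is piecewise smooth with finitely many kinks, so integration by parts holds without
  face terms, and periodicity removes the end points (\<open>integral_axis_derivative_eq_0\<close>,
  \<open>V_space_weak_grad\<close>). A Nedelec element has a weak curl by definition of its space; testing with
  functions that vanish off a cell shows that it is the classical curl there
  (\<open>weak_curl_eq_classical_on_subbox\<close>), and the scaling of the two reference maps together with
  a count of degrees makes it a Raviart--Thomas polynomial.
\<close>


section \<open>Partial derivatives and smooth periodic functions\<close>

lemma partial_eqI:
  assumes "(f has_derivative f') (at x)"
  shows "partial l f x = f' (axis l 1)"
  using frechet_derivative_at[OF assms] by (simp add: partial_def)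

lemma has_derivative_partial:
  assumes "f differentiable at x"
  shows "(f has_derivative frechet_derivative f (at x)) (at x)"
  using assms frechet_derivative_works by blast

lemma partial_mult:
  assumes "f differentiable at x" "g differentiable at x"
  shows "partial l (\<lambda>y. f y * g y) x = f x * partial l g x + partial l f x * g x"
  unfolding partial_def[of l f] partial_def[of l g]
  by (rule partial_eqI)
     (intro has_derivative_mult has_derivative_partial assms)

lemma partial_add:
  assumes "f differentiable at x" "g differentiable at x"
  shows "partial l (\<lambda>y. f y + g y) x = partial l f x + partial l g x"
  unfolding partial_def[of l f] partial_def[of l g]
  by (rule partial_eqI) (intro has_derivative_add has_derivative_partial assms)

lemma partial_const [simp]: "partial l (\<lambda>y. c) x = 0"
  by (rule partial_eqI) (rule has_derivative_const)

lemma partial_cmult: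
  assumes "f differentiable at x"
  shows "partial l (\<lambda>y. c * f y) x = c * partial l f x"
  using partial_mult[of "\<lambda>_. c" x f l] assms by simp

lemma partial_diff:
  assumes "f differentiable at x" "g differentiable at x"
  shows "partial l (\<lambda>y. f y - g y) x = partial l f x - partial l g x"
  unfolding partial_def[of l f] partial_def[of l g]
  by (rule partial_eqI) (intro has_derivative_diff has_derivative_partial assms)

lemma has_real_derivative_along_axis:
  assumes "f differentiable at (y + s *\<^sub>R axis l 1)"
  shows "((\<lambda>t. f (y + t *\<^sub>R axis l 1)) has_real_derivative partial l f (y + s *\<^sub>R axis l 1)) (at s)"
proof -
  have 1: "((\<lambda>t. y + t *\<^sub>R axis l 1) has_derivative (\<lambda>t. t *\<^sub>R axis l 1)) (at s)"
    by (auto intro!: derivative_eq_intros)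
  have 2: "((\<lambda>t. f (y + t *\<^sub>R axis l 1)) has_derivative
      (\<lambda>t. frechet_derivative f (at (y + s *\<^sub>R axis l 1)) (t *\<^sub>R axis l 1))) (at s)"
    by (rule has_derivative_compose[OF 1 has_derivative_partial[OF assms]])
  have "frechet_derivative f (at (y + s *\<^sub>R axis l 1)) (t *\<^sub>R axis l 1)
      = t * partial l f (y + s *\<^sub>R axis l 1)" for t
    using linear_frechet_derivative[OF assms] by (simp add: partial_def linear_scale)
  with 2 show ?thesis
    by (simp add: has_field_derivative_def mult_commute_abs)
qed

lemma Ck_Suc_imp_Ck: "Ck (Suc n) f \<Longrightarrow> Ck n f"
proof (induction n arbitrary: f)
  case 0
  then show ?case
    by (simp add: continuous_at_imp_continuous_on differentiable_imp_continuous_within)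
next
  case (Suc n)
  then show ?case by (metis Ck.simps(2))
qed

lemma Ck_const [simp]: "Ck n (\<lambda>x. c)"
proof (induction n arbitrary: c)
  case (Suc n)
  have "partial l (\<lambda>x. c) = (\<lambda>x. 0)" for l by (simp add: fun_eq_iff)
  then show ?case using Suc by simp
qed simp

lemma Ck_add: "Ck n f \<Longrightarrow> Ck n g \<Longrightarrow> Ck n (\<lambda>x. f x + g x)"
proof (induction n arbitrary: f g)
  case (Suc n)
  then have "partial l (\<lambda>x. f x + g x) = (\<lambda>x. partial l f x + partial l g x)" for l
    by (simp add: fun_eq_iff partial_add)
  then show ?case using Suc by simp
qed (simp add: continuous_on_add)

lemma Ck_mult: "Ck n f \<Longrightarrow> Ck n g \<Longrightarrow> Ck n (\<lambda>x. f x * g x)"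
proof (induction n arbitrary: f g)
  case (Suc n)
  then have "partial l (\<lambda>x. f x * g x) = (\<lambda>x. f x * partial l g x + partial l f x * g x)" for l
    by (simp add: fun_eq_iff partial_mult)
  moreover have "Ck n f" "Ck n g" using Suc.prems Ck_Suc_imp_Ck by blast+
  ultimately show ?case using Suc by (simp add: Ck_add)
qed (simp add: continuous_on_mult)

lemma Ck_diff: "Ck n f \<Longrightarrow> Ck n g \<Longrightarrow> Ck n (\<lambda>x. f x - g x)"
  using Ck_add[of n f "\<lambda>x. -1 * g x"] Ck_mult[of n "\<lambda>_. -1" g] by simp

lemma Ck_prod: "(\<And>i. i \<in> S \<Longrightarrow> Ck n (f i)) \<Longrightarrow> Ck n (\<lambda>x. \<Prod>i\<in>S. f i x)"
  by (induction S rule: infinite_finite_induct) (auto intro: Ck_mult)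

text \<open>
  Indexing the iterated derivatives of the outer function by \<open>j\<close> makes the chain rule
  reproduce a composition of the same shape, so that no formula for higher derivatives of a
  composite is needed.
\<close>

lemma Ck_compose:
  fixes F :: "nat \<Rightarrow> real \<Rightarrow> real"
  assumes F: "\<And>j t. (F j has_real_derivative F (Suc j) t) (at t)"
  shows "Ck n h \<Longrightarrow> Ck n (\<lambda>x. F j (h x))"
proof (induction n arbitrary: j)
  case 0
  have "continuous_on UNIV (F j)"
    using F by (meson DERIV_continuous continuous_at_imp_continuous_on)
  with 0 show ?case
    using continuous_on_compose2[of UNIV "F j" UNIV h] by simp
next
  case (Suc n)
  have d: "h differentiable at x" for x using Suc.prems by simp
  have D: "((\<lambda>x. F j (h x)) has_derivative
      (\<lambda>v. F (Suc j) (h x) * frechet_derivative h (at x) v)) (at x)" for x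
    using has_derivative_compose[OF has_derivative_partial[OF d], of "F j"] F
    by (simp add: has_field_derivative_def)
  have "partial l (\<lambda>x. F j (h x)) = (\<lambda>x. F (Suc j) (h x) * partial l h x)" for l
    using partial_eqI[OF D] by (simp add: fun_eq_iff partial_def)
  moreover have "(\<lambda>x. F j (h x)) differentiable at x" for x
    using D differentiable_def by blast
  moreover have "Ck n h" using Suc.prems Ck_Suc_imp_Ck by blast
  ultimately show ?case using Suc by (simp add: Ck_mult)
qed

lemma Ck_component: "Ck n (\<lambda>x. x $ l)"
proof (cases n)
  case (Suc m)
  have d: "((\<lambda>x. x $ l) has_derivative (\<lambda>v. v $ l)) (at x)" for x :: "real^3"
    by (rule bounded_linear_imp_has_derivative) (rule bounded_linear_vec_nth)
  then have "partial i (\<lambda>x. x $ l) = (\<lambda>x. axis i 1 $ l)" for i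
    by (auto simp: fun_eq_iff dest!: partial_eqI)
  then show ?thesis using d Suc by (auto simp: differentiable_def)
qed (simp add: continuous_on_component)

lemma mixed_difference_eq:
  assumes f: "Ck 2 f" and h: "h > 0"
  obtains y where "dist y x \<le> 2 * h"
    "f (x + h *\<^sub>R axis l 1 + h *\<^sub>R axis m 1) - f (x + h *\<^sub>R axis l 1)
       - f (x + h *\<^sub>R axis m 1) + f x = h\<^sup>2 * partial m (partial l f) y"
proof -
  have d: "f differentiable at y" "partial l f differentiable at y" for y
    using f by (simp_all add: numeral_2_eq_2)
  define G where "G s = f (x + h *\<^sub>R axis m 1 + s *\<^sub>R axis l 1) - f (x + s *\<^sub>R axis l 1)" for s
  have "(G has_real_derivative (partial l f (x + h *\<^sub>R axis m 1 + s *\<^sub>R axis l 1)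
      - partial l f (x + s *\<^sub>R axis l 1))) (at s)" for s
    unfolding G_def by (intro DERIV_diff has_real_derivative_along_axis d)
  from MVT2[OF h this] obtain s where s: "0 < s" "s < h"
    and Gs: "G h - G 0 = h * (partial l f (x + h *\<^sub>R axis m 1 + s *\<^sub>R axis l 1)
      - partial l f (x + s *\<^sub>R axis l 1))"
    by auto
  define y where "y = x + s *\<^sub>R axis l 1"
  have "((\<lambda>t. partial l f (y + t *\<^sub>R axis m 1)) has_real_derivative
      partial m (partial l f) (y + t *\<^sub>R axis m 1)) (at t)" for t
    by (intro has_real_derivative_along_axis d)
  from MVT2[OF h this] obtain t where t: "0 < t" "t < h"
    and Gt: "partial l f (y + h *\<^sub>R axis m 1) - partial l f (y + 0 *\<^sub>R axis m 1)
      = h * partial m (partial l f) (y + t *\<^sub>R axis m 1)"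
    by auto
  have "dist (y + t *\<^sub>R axis m 1) x = norm (s *\<^sub>R axis l (1::real) + t *\<^sub>R axis m 1)"
    by (simp add: y_def dist_norm)
  also have "\<dots> \<le> s + t"
    using s t norm_triangle_ineq[of "s *\<^sub>R axis l (1::real)" "t *\<^sub>R axis m 1"] by simp
  also have "\<dots> \<le> 2 * h" using s t by simp
  finally have "dist (y + t *\<^sub>R axis m 1) x \<le> 2 * h" .
  moreover have "G h - G 0 = h * (h * partial m (partial l f) (y + t *\<^sub>R axis m 1))"
    using Gs Gt by (simp add: y_def add_ac)
  ultimately show thesis
    using that[of "y + t *\<^sub>R axis m 1"]
    by (simp add: G_def power2_eq_square algebra_simps)
qed

text \<open>
  Both mixed derivatives are limits of the same second difference quotient, by two
  applications of the mean value theorem in either order.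
\<close>

lemma partial_commute:
  assumes f: "Ck 2 f"
  shows "partial l (partial m f) x = partial m (partial l f) x"
proof -
  define h where "h n = 1 / real (Suc n)" for n
  have h: "h n > 0" for n by (simp add: h_def)
  have "\<exists>y z. dist y x \<le> 2 * h n \<and> dist z x \<le> 2 * h n \<and>
      partial m (partial l f) y = partial l (partial m f) z" for n
  proof -
    obtain y where y: "dist y x \<le> 2 * h n"
      "f (x + h n *\<^sub>R axis l 1 + h n *\<^sub>R axis m 1) - f (x + h n *\<^sub>R axis l 1)
       - f (x + h n *\<^sub>R axis m 1) + f x = (h n)\<^sup>2 * partial m (partial l f) y"
      using mixed_difference_eq[OF f h] by blast
    obtain z where z: "dist z x \<le> 2 * h n"
      "f (x + h n *\<^sub>R axis m 1 + h n *\<^sub>R axis l 1) - f (x + h n *\<^sub>R axis m 1)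
       - f (x + h n *\<^sub>R axis l 1) + f x = (h n)\<^sup>2 * partial l (partial m f) z"
      using mixed_difference_eq[OF f h] by blast
    have "(h n)\<^sup>2 * partial m (partial l f) y = (h n)\<^sup>2 * partial l (partial m f) z"
      using y(2) z(2) unfolding add.assoc[of x] add.commute[of "h n *\<^sub>R axis m 1" "h n *\<^sub>R axis l 1"]
      by linarith
    then show ?thesis using y z h[of n] by (intro exI[of _ y] exI[of _ z]) simp
  qed
  then obtain y z where yz: "\<And>n. dist (y n) x \<le> 2 * h n" "\<And>n. dist (z n) x \<le> 2 * h n"
    "\<And>n. partial m (partial l f) (y n) = partial l (partial m f) (z n)"
    by metis
  have h0: "(\<lambda>n. 2 * h n) \<longlonglongrightarrow> 0"
    using tendsto_mult_right[OF LIMSEQ_inverse_real_of_nat, of 2]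
    by (simp add: h_def inverse_eq_divide)
  have "y \<longlonglongrightarrow> x" "z \<longlonglongrightarrow> x"
    using yz h0 by (auto intro!: metric_tendsto_imp_tendsto[OF h0] simp: eventually_sequentially h_def)
  moreover have c: "isCont (partial m (partial l f)) x" "isCont (partial l (partial m f)) x"
    using f by (simp_all add: numeral_2_eq_2 continuous_on_eq_continuous_at)
  ultimately have "(\<lambda>n. partial m (partial l f) (y n)) \<longlonglongrightarrow> partial m (partial l f) x"
    "(\<lambda>n. partial l (partial m f) (z n)) \<longlonglongrightarrow> partial l (partial m f) x"
    using isCont_tendsto_compose by blast+
  then show ?thesis using yz(3) LIMSEQ_unique by (metis (no_types, lifting) ext)
qed

lemma test_scalar_Ck: "\<psi> \<in> test_scalar a b \<Longrightarrow> Ck n \<psi>"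
  by (simp add: test_scalar_def)

lemma test_scalar_differentiable: "\<psi> \<in> test_scalar a b \<Longrightarrow> \<psi> differentiable at x"
  using test_scalar_Ck[of \<psi> a b "Suc 0"] by simp

lemma test_scalar_continuous: "\<psi> \<in> test_scalar a b \<Longrightarrow> continuous_on S \<psi>"
  using test_scalar_Ck[of \<psi> a b 0] continuous_on_subset by fastforce

lemma test_scalar_periodic:
  "\<psi> \<in> test_scalar a b \<Longrightarrow> \<psi> (x + (b $ l - a $ l) *\<^sub>R axis l 1) = \<psi> x"
  by (simp add: test_scalar_def)

lemma test_scalar_partial:
  assumes "\<psi> \<in> test_scalar a b"
  shows "partial l \<psi> \<in> test_scalar a b"
proof -
  have "Ck n (partial l \<psi>)" for n using test_scalar_Ck[OF assms, of "Suc n"] by simp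
  moreover have "partial l \<psi> (x + (b $ m - a $ m) *\<^sub>R axis m 1) = partial l \<psi> x" for x m
  proof -
    let ?p = "(b $ m - a $ m) *\<^sub>R axis m (1::real)"
    have 1: "((\<lambda>y. y + ?p) has_derivative (\<lambda>v. v)) (at x)"
      by (auto intro!: derivative_eq_intros)
    have "((\<lambda>y. \<psi> (y + ?p)) has_derivative frechet_derivative \<psi> (at (x + ?p))) (at x)"
      by (rule has_derivative_compose[OF 1 has_derivative_partial])
         (rule test_scalar_differentiable[OF assms])
    then have "(\<psi> has_derivative frechet_derivative \<psi> (at (x + ?p))) (at x)"
      by (simp add: test_scalar_periodic[OF assms])
    from partial_eqI[OF this, of l] show ?thesis by (simp add: partial_def)
  qed
  ultimately show ?thesis by (simp add: test_scalar_def)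
qed

lemma test_scalar_zero [simp]: "(\<lambda>x. 0) \<in> test_scalar a b"
  by (simp add: test_scalar_def)

lemma test_scalar_diff:
  "f \<in> test_scalar a b \<Longrightarrow> g \<in> test_scalar a b \<Longrightarrow> (\<lambda>x. f x - g x) \<in> test_scalar a b"
  by (auto simp: test_scalar_def Ck_diff)

lemma test_vector_component: "\<psi> \<in> test_vector a b \<Longrightarrow> (\<lambda>x. \<psi> x $ l) \<in> test_scalar a b"
  by (simp add: test_vector_def)

lemma test_vector_axis:
  assumes "\<psi> \<in> test_scalar a b"
  shows "(\<lambda>x. axis m (\<psi> x)) \<in> test_vector a b"
proof -
  have "(\<lambda>x. axis m (\<psi> x) $ l) = (if l = m then \<psi> else (\<lambda>x. 0))" for l
    by (auto simp: axis_def)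
  then show ?thesis using assms by (simp add: test_vector_def)
qed

lemma index_3_add:
  "(1::3) + 1 = 2" "(1::3) + 2 = 3" "(2::3) + 1 = 3" "(2::3) + 2 = 1" "(3::3) + 1 = 1" "(3::3) + 2 = 2"
  by simp_all

text \<open>
  The index type \<open>3\<close> is arithmetic modulo \<open>3\<close>; writing the curl cyclically treats its three
  components alike.
\<close>

lemma classical_curl_component:
  "classical_curl f x $ l
     = partial (l + 1) (\<lambda>y. f y $ (l + 2)) x - partial (l + 2) (\<lambda>y. f y $ (l + 1)) x"
proof -
  have "l = 1 \<or> l = 2 \<or> l = 3" by (rule exhaust_3)
  then show ?thesis
    by (elim disjE; hypsubst; simp only: index_3_add classical_curl_def vector_3)
qed

lemma classical_grad_test_vector: "\<psi> \<in> test_scalar a b \<Longrightarrow> classical_grad \<psi> \<in> test_vector a b"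
  by (simp add: test_vector_def classical_grad_def test_scalar_partial)

lemma classical_curl_test_vector: "\<psi> \<in> test_vector a b \<Longrightarrow> classical_curl \<psi> \<in> test_vector a b"
  by (simp add: test_vector_def classical_curl_component test_scalar_partial test_scalar_diff)

lemma curl_grad_test_scalar:
  assumes "\<psi> \<in> test_scalar a b"
  shows "classical_curl (classical_grad \<psi>) x = 0"
  using partial_commute[OF test_scalar_Ck[OF assms]]
  by (simp add: vec_eq_iff classical_curl_component classical_grad_def)

lemma div_curl_test_vector:
  assumes "\<psi> \<in> test_vector a b"
  shows "classical_div (classical_curl \<psi>) x = 0"
proof -
  note c = test_vector_component[OF assms]
  have "partial l (\<lambda>y. classical_curl \<psi> y $ l) x
      = partial l (partial (l + 1) (\<lambda>y. \<psi> y $ (l + 2))) x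
        - partial l (partial (l + 2) (\<lambda>y. \<psi> y $ (l + 1))) x" for l
    unfolding classical_curl_component
    by (intro partial_diff test_scalar_differentiable[of _ a b] test_scalar_partial c)
  note this[of 1, unfolded index_3_add] this[of 2, unfolded index_3_add] this[of 3, unfolded index_3_add]
  then show ?thesis
    using partial_commute[OF test_scalar_Ck[OF c]]
    by (simp add: classical_div_def sum_3)
qed

section \<open>Integrating a derivative along an axis over a box\<close>

lemma LINT_box_eq_lborel:
  fixes H :: "real^3 \<Rightarrow> real"
  assumes [measurable]: "H \<in> borel_measurable borel"
  shows "(LINT x|lebesgue_on (box u v). H x) = (\<integral>x. indicator (box u v) x * H x \<partial>lborel)"
proof -
  have "(LINT x|lebesgue_on (box u v). H x) = (\<integral>x. indicator (box u v) x * H x \<partial>lebesgue)"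
    by (simp add: integral_restrict_space)
  also have "\<dots> = (\<integral>x. indicator (box u v) x * H x \<partial>lborel)"
    by (rule integral_completion) simp
  finally show ?thesis .
qed

lemma mem_box_add_axis:
  fixes x :: "real^3"
  shows "x + s *\<^sub>R axis l 1 \<in> cbox u v \<longleftrightarrow>
      (\<forall>m. m \<noteq> l \<longrightarrow> u $ m \<le> x $ m \<and> x $ m \<le> v $ m) \<and> u $ l \<le> x $ l + s \<and> x $ l + s \<le> v $ l"
    and "x + s *\<^sub>R axis l 1 \<in> box u v \<longleftrightarrow>
      (\<forall>m. m \<noteq> l \<longrightarrow> u $ m < x $ m \<and> x $ m < v $ m) \<and> u $ l < x $ l + s \<and> x $ l + s < v $ l"
  by (auto simp: mem_box_cart axis_def)

text \<open>
  A form of Fubini's theorem that needs no splitting of coordinates: integrating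
  \<open>H (x + s e\<^sub>l)\<close> over \<open>x\<close> in the box and \<open>s\<close> in \<open>\<real>\<close> gives \<open>0\<close> in one order and, by
  translation invariance, the edge length times the integral of \<open>H\<close> in the other.
\<close>

lemma integral_eq_0_if_axis_integrals_eq_0:
  fixes H :: "real^3 \<Rightarrow> real"
  assumes uv: "\<forall>l. u $ l < v $ l"
    and [measurable]: "H \<in> borel_measurable borel"
    and bound: "\<And>x. \<bar>H x\<bar> \<le> M"
    and supp: "\<And>x. x \<notin> cbox u v \<Longrightarrow> H x = 0"
    and lines: "AE x in lborel. x \<in> cbox u v \<longrightarrow> (\<integral>s. H (x + s *\<^sub>R axis l 1) \<partial>lborel) = 0"
  shows "(\<integral>x. H x \<partial>lborel) = 0"
proof -
  define L where "L = v $ l - u $ l"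
  have L: "L > 0" using uv by (simp add: L_def)
  have M: "0 \<le> M" using bound[of 0] by linarith
  let ?e = "axis l (1::real) :: real^3"
  let ?K = "cbox u v"
  \<comment> \<open>Two points of the box on one line parallel to the axis are at most \<open>L\<close> apart, so \<open>Z\<close> contains the
     supports of both integrands below.\<close>
  define Z where "Z = cbox (u, -L) (v, L)"
  have Z: "x \<in> ?K \<Longrightarrow> x + s *\<^sub>R ?e \<in> ?K \<Longrightarrow> (x, s) \<in> Z"
    "x \<in> ?K \<Longrightarrow> x - s *\<^sub>R ?e \<in> ?K \<Longrightarrow> (x, s) \<in> Z" for x s
    using mem_box_add_axis(1)[of x s l u v] mem_box_add_axis(1)[of x "-s" l u v]
      mem_box_add_axis(1)[of x 0 l u v]
    by (auto simp: Z_def cbox_Pair_eq L_def)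
  have intZ: "integrable lborel (\<lambda>z. M * indicator Z z)"
    unfolding Z_def
    by (rule integrable_mult_right, rule integrable_real_indicator)
       (simp, rule emeasure_lborel_cbox_finite)
  have int1: "integrable (lborel \<Otimes>\<^sub>M lborel) (\<lambda>(x, s). indicator ?K x * H (x + s *\<^sub>R ?e))"
    unfolding lborel_prod
  proof (rule Bochner_Integration.integrable_bound[OF intZ])
    have "(\<lambda>(x, s). indicator ?K x * H (x + s *\<^sub>R ?e)) \<in> borel_measurable (borel \<Otimes>\<^sub>M borel)"
      by measurable
    then show "(\<lambda>(x, s). indicator ?K x * H (x + s *\<^sub>R ?e)) \<in> borel_measurable lborel"
      by (simp add: borel_prod)
    have "\<bar>indicator ?K x * H (x + s *\<^sub>R ?e)\<bar> \<le> M * indicator Z (x, s)" for x s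
      using Z(1)[of x s] bound[of "x + s *\<^sub>R ?e"] supp[of "x + s *\<^sub>R ?e"] M
      by (cases "x \<in> ?K \<and> x + s *\<^sub>R ?e \<in> ?K") (auto simp: indicator_def)
    then show "AE z in lborel. norm (case z of (x, s) \<Rightarrow> indicator ?K x * H (x + s *\<^sub>R ?e))
        \<le> norm (M * indicator Z z)"
      using M by (auto simp: abs_mult)
  qed
  have int2: "integrable (lborel \<Otimes>\<^sub>M lborel) (\<lambda>(x, s). indicator ?K (x - s *\<^sub>R ?e) * H x)"
    unfolding lborel_prod
  proof (rule Bochner_Integration.integrable_bound[OF intZ])
    have "(\<lambda>(x, s). indicator ?K (x - s *\<^sub>R ?e) * H x) \<in> borel_measurable (borel \<Otimes>\<^sub>M borel)"
      by measurable
    then show "(\<lambda>(x, s). indicator ?K (x - s *\<^sub>R ?e) * H x) \<in> borel_measurable lborel"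
      by (simp add: borel_prod)
    have "\<bar>indicator ?K (x - s *\<^sub>R ?e) * H x\<bar> \<le> M * indicator Z (x, s)" for x s
      using Z(2)[of x s] bound[of x] supp[of x] M
      by (cases "x \<in> ?K \<and> x - s *\<^sub>R ?e \<in> ?K") (auto simp: indicator_def)
    then show "AE z in lborel. norm (case z of (x, s) \<Rightarrow> indicator ?K (x - s *\<^sub>R ?e) * H x)
        \<le> norm (M * indicator Z z)"
      using M by (auto simp: abs_mult)
  qed
  have shift: "(\<integral>x. indicator ?K x * H (x + s *\<^sub>R ?e) \<partial>lborel)
      = (\<integral>x. indicator ?K (x - s *\<^sub>R ?e) * H x \<partial>lborel)" for s
  proof -
    have "(\<integral>x. indicator ?K (x - s *\<^sub>R ?e) * H x \<partial>lborel)
        = (\<integral>x. indicator ?K (x - s *\<^sub>R ?e) * H x \<partial>distr lborel borel ((+) (s *\<^sub>R ?e)))"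
      by (simp add: lborel_distr_plus)
    also have "\<dots> = (\<integral>x. indicator ?K x * H (x + s *\<^sub>R ?e) \<partial>lborel)"
      by (subst integral_distr) (auto simp: add.commute)
    finally show ?thesis by simp
  qed
  have length: "(\<integral>s. indicator ?K (x - s *\<^sub>R ?e) \<partial>lborel) = L" if "x \<in> ?K" for x
  proof -
    have "indicator ?K (x - s *\<^sub>R ?e) = (indicator {x $ l - v $ l..x $ l - u $ l} s :: real)" for s
      using that mem_box_add_axis(1)[of x "-s" l u v] mem_box_add_axis(1)[of x 0 l u v]
      by (auto simp: indicator_def)
    then show ?thesis
      using that uv[rule_format, of l] by (simp add: L_def)
  qed
  have "0 = (\<integral>x. indicator ?K x * (\<integral>s. H (x + s *\<^sub>R ?e) \<partial>lborel) \<partial>lborel)"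
    using lines by (subst integral_cong_AE[where g = "\<lambda>x. 0"]) auto
  also have "\<dots> = (\<integral>x. (\<integral>s. indicator ?K x * H (x + s *\<^sub>R ?e) \<partial>lborel) \<partial>lborel)"
    by simp
  also have "\<dots> = (\<integral>s. (\<integral>x. indicator ?K x * H (x + s *\<^sub>R ?e) \<partial>lborel) \<partial>lborel)"
    by (rule lborel_pair.Fubini_integral[symmetric]) (use int1 in simp)
  also have "\<dots> = (\<integral>s. (\<integral>x. indicator ?K (x - s *\<^sub>R ?e) * H x \<partial>lborel) \<partial>lborel)"
    by (simp add: shift)
  also have "\<dots> = (\<integral>x. (\<integral>s. indicator ?K (x - s *\<^sub>R ?e) * H x \<partial>lborel) \<partial>lborel)"
    by (rule lborel_pair.Fubini_integral) (use int2 in simp)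
  also have "\<dots> = (\<integral>x. L * H x \<partial>lborel)"
  proof (rule Bochner_Integration.integral_cong[OF refl])
    fix x
    show "(\<integral>s. indicator ?K (x - s *\<^sub>R ?e) * H x \<partial>lborel) = L * H x"
      using length[of x] supp[of x] by (cases "x \<in> ?K") simp_all
  qed
  finally show ?thesis using L by simp
qed

lemma negligible_coordinates_in_finite:
  assumes "finite D"
  shows "negligible {x :: real^3. \<exists>m. x $ m \<in> D}"
proof -
  have "{x :: real^3. \<exists>m. x $ m \<in> D} = (\<Union>m. \<Union>d\<in>D. {x. x $ m = d})" by auto
  then show ?thesis
    using assms
    by (auto intro!: negligible_Union negligible_standard_hyperplane simp: cart_eq_inner_axis axis_in_Basis_iff)
qed

text \<open>
  Away from the finite set \<open>D\<close> of coordinate values, where the integrand may jump, the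
  fundamental theorem of calculus applies on almost every line parallel to the axis; continuity of
  \<open>F\<close> takes care of the finitely many exceptional points on that line.
\<close>

lemma integral_axis_derivative_eq_0:
  fixes F H :: "real^3 \<Rightarrow> real"
  assumes uv: "\<forall>l. u $ l < v $ l"
    and [measurable]: "H \<in> borel_measurable borel"
    and bound: "\<And>x. x \<in> box u v \<Longrightarrow> \<bar>H x\<bar> \<le> M"
    and cont: "continuous_on (cbox u v) F"
    and D: "finite D"
    and deriv: "\<And>x. x \<in> box u v \<Longrightarrow> \<forall>m. x $ m \<notin> D \<Longrightarrow>
        ((\<lambda>t. F (x + t *\<^sub>R axis l 1)) has_real_derivative H x) (at 0)"
    and ends: "\<And>x. x \<in> cbox u v \<Longrightarrow> x $ l = u $ l \<Longrightarrow>
        F (x + (v $ l - u $ l) *\<^sub>R axis l 1) = F x"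
  shows "(LINT x|lebesgue_on (box u v). H x) = 0"
proof -
  let ?e = "axis l (1::real) :: real^3"
  let ?H = "\<lambda>x. indicator (box u v) x * H x"
  \<comment> \<open>Almost every line avoids these values in the other two coordinates.\<close>
  define D' where "D' = D \<union> range (\<lambda>m. u $ m) \<union> range (\<lambda>m. v $ m)"
  have neg: "AE x in lborel. x \<notin> {x :: real^3. \<exists>m. x $ m \<in> D'}"
  proof -
    have "{x :: real^3. \<exists>m. x $ m \<in> D'} \<in> null_sets lebesgue"
      using negligible_coordinates_in_finite[of D'] D by (simp add: D'_def negligible_iff_null_sets)
    then have "AE x in lebesgue. x \<notin> {x :: real^3. \<exists>m. x $ m \<in> D'}"
      by (rule AE_not_in)
    then show ?thesis by (simp add: AE_completion_iff)
  qed
  have Hb: "\<bar>?H x\<bar> \<le> \<bar>M\<bar>" for x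
    using bound[of x] by (auto simp: indicator_def)
  have "(\<integral>x. ?H x \<partial>lborel) = 0"
  proof (rule integral_eq_0_if_axis_integrals_eq_0[OF uv _ Hb])
    show "AE x in lborel. x \<in> cbox u v \<longrightarrow> (\<integral>s. ?H (x + s *\<^sub>R ?e) \<partial>lborel) = 0"
      using neg
    proof eventually_elim
      fix x :: "real^3" assume x: "x \<notin> {x. \<exists>m. x $ m \<in> D'}"
      show "x \<in> cbox u v \<longrightarrow> (\<integral>s. ?H (x + s *\<^sub>R ?e) \<partial>lborel) = 0"
      proof
        assume xK: "x \<in> cbox u v"
        have xb: "u $ m < x $ m" "x $ m < v $ m" for m
        proof -
          have "u $ m \<in> D'" "v $ m \<in> D'" "x $ m \<notin> D'" using x by (auto simp: D'_def)
          then have "x $ m \<noteq> u $ m" "x $ m \<noteq> v $ m" by (metis (full_types))+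
          then show "u $ m < x $ m" "x $ m < v $ m"
            using xK[unfolded mem_box_cart, rule_format, of m] by auto
        qed
        define s0 s1 where "s0 = u $ l - x $ l" and "s1 = v $ l - x $ l"
        have s01: "s0 < s1" using uv by (simp add: s0_def s1_def)
        have in_box: "x + s *\<^sub>R ?e \<in> box u v \<longleftrightarrow> s \<in> {s0<..<s1}" for s
          using xb by (auto simp: mem_box_add_axis s0_def s1_def)
        have in_cbox: "x + s *\<^sub>R ?e \<in> cbox u v \<longleftrightarrow> s \<in> {s0..s1}" for s
          using xb by (auto simp: mem_box_add_axis s0_def s1_def less_imp_le)
        define f where "f s = F (x + s *\<^sub>R ?e)" for s
        have "((\<lambda>s. H (x + s *\<^sub>R ?e)) has_integral f s1 - f s0) {s0..s1}"
        proof (rule fundamental_theorem_of_calculus_interior_strong[where S = "(\<lambda>d. d - x $ l) ` D"])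
          show "finite ((\<lambda>d. d - x $ l) ` D)" using D by simp
          show "s0 \<le> s1" using s01 by simp
          show "continuous_on {s0..s1} f"
            unfolding f_def
          proof (rule continuous_on_compose2[OF cont])
            show "continuous_on {s0..s1} (\<lambda>s. x + s *\<^sub>R ?e)" by (intro continuous_intros)
            show "(\<lambda>s. x + s *\<^sub>R ?e) ` {s0..s1} \<subseteq> cbox u v" using in_cbox by blast
          qed
          fix s assume s: "s \<in> {s0<..<s1} - (\<lambda>d. d - x $ l) ` D"
          have "\<forall>m. (x + s *\<^sub>R ?e) $ m \<notin> D"
          proof
            fix m
            show "(x + s *\<^sub>R ?e) $ m \<notin> D"
            proof (cases "m = l")
              case True
              have "x $ l + s \<notin> D"
              proof
                assume "x $ l + s \<in> D"
                then have "(x $ l + s) - x $ l \<in> (\<lambda>d. d - x $ l) ` D" by (rule imageI)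
                then show False using s by simp
              qed
              then show ?thesis using True by simp
            next
              case False
              then show ?thesis using x by (auto simp: axis_def D'_def)
            qed
          qed
          with deriv[of "x + s *\<^sub>R ?e"] s in_box
          have "((\<lambda>t. F (x + s *\<^sub>R ?e + t *\<^sub>R ?e)) has_real_derivative H (x + s *\<^sub>R ?e)) (at 0)"
            by blast
          then have "((\<lambda>t. f (t + s)) has_real_derivative H (x + s *\<^sub>R ?e)) (at 0)"
            by (simp add: f_def algebra_simps)
          then have "(f has_real_derivative H (x + s *\<^sub>R ?e)) (at (0 + s))"
            by (simp only: DERIV_shift)
          then show "(f has_vector_derivative H (x + s *\<^sub>R ?e)) (at s)"
            by (simp add: has_real_derivative_iff_has_vector_derivative)
        qed
        moreover have "f s1 = f s0"
        proof -
          have "F (x + s0 *\<^sub>R ?e + (v $ l - u $ l) *\<^sub>R ?e) = F (x + s0 *\<^sub>R ?e)"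
            by (rule ends) (use in_cbox s01 in \<open>auto simp: s0_def\<close>)
          moreover have "x + s0 *\<^sub>R ?e + (v $ l - u $ l) *\<^sub>R ?e = x + s1 *\<^sub>R ?e"
            by (simp add: s0_def s1_def algebra_simps)
          ultimately show ?thesis by (simp add: f_def)
        qed
        ultimately have "((\<lambda>s. H (x + s *\<^sub>R ?e)) has_integral 0) {s0<..<s1}"
          by (simp add: has_integral_Icc_iff_Ioo)
        then have "((\<lambda>s. if s \<in> {s0<..<s1} then H (x + s *\<^sub>R ?e) else 0) has_integral 0) UNIV"
          by (simp only: has_integral_restrict_UNIV)
        moreover have "(\<lambda>s. if s \<in> {s0<..<s1} then H (x + s *\<^sub>R ?e) else 0)
            = (\<lambda>s. ?H (x + s *\<^sub>R ?e))"
          using in_box by (auto simp: fun_eq_iff indicator_def)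
        moreover have "integrable lborel (\<lambda>s. ?H (x + s *\<^sub>R ?e))"
        proof (rule Bochner_Integration.integrable_bound[where f = "\<lambda>s. \<bar>M\<bar> * indicator {s0..s1} s"])
          show "integrable lborel (\<lambda>s. \<bar>M\<bar> * indicator {s0..s1} s)"
            by (rule integrable_mult_right, rule integrable_real_indicator)
               (simp, metis cbox_interval emeasure_lborel_cbox_finite)
          have "\<bar>?H (x + s *\<^sub>R ?e)\<bar> \<le> \<bar>M\<bar> * indicator {s0..s1} s" for s
            using Hb[of "x + s *\<^sub>R ?e"] in_box[of s] by (auto simp: indicator_def)
          then show "AE s in lborel. norm (?H (x + s *\<^sub>R ?e)) \<le> norm (\<bar>M\<bar> * indicator {s0..s1} s)"
            by (auto simp: abs_mult)
        qed simp
        ultimately show "(\<integral>s. ?H (x + s *\<^sub>R ?e) \<partial>lborel) = 0"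
          by (metis (no_types) has_integral_unique[OF has_integral_integral_lborel[where f = "\<lambda>s. ?H (x + s *\<^sub>R ?e)"]])
      qed
    qed
  next
    show "?H x = 0" if "x \<notin> cbox u v" for x
      using that box_subset_cbox by (auto simp: indicator_def)
  qed measurable
  then show ?thesis by (simp add: LINT_box_eq_lborel)
qed

section \<open>The fundamental lemma of the calculus of variations\<close>

lemma poly_div_exp_tendsto_0: "((\<lambda>x. poly p x / exp x) \<longlongrightarrow> (0::real)) at_top"
proof -
  have "((\<lambda>x. \<Sum>i\<le>degree p. coeff p i * (x ^ i / exp x)) \<longlongrightarrow> (\<Sum>i\<le>degree p. coeff p i * 0)) at_top"
    by (intro tendsto_intros tendsto_power_div_exp_0)
  then show ?thesis by (simp add: poly_altdef sum_divide_distrib)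
qed

text \<open>
  Differentiating \<open>p (1 / t) * exp (- 1 / t)\<close> replaces \<open>p\<close> by \<open>x\<^sup>2 (p - p')\<close>.
\<close>

primrec flat_poly :: "nat \<Rightarrow> real poly" where
  "flat_poly 0 = 1"
| "flat_poly (Suc j) = monom 1 2 * (flat_poly j - pderiv (flat_poly j))"

text \<open>The \<open>j\<close>-th derivative of the flat function that is \<open>exp (- 1 / t)\<close> for \<open>t > 0\<close>.\<close>

definition flat_deriv :: "nat \<Rightarrow> real \<Rightarrow> real" where
  "flat_deriv j t = (if t > 0 then poly (flat_poly j) (1 / t) * exp (- (1 / t)) else 0)"

lemma flat_deriv_has_derivative: "(flat_deriv j has_real_derivative flat_deriv (Suc j) t) (at t)"
proof -
  consider "t > 0" | "t < 0" | "t = 0" by linarith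
  then show ?thesis
  proof cases
    case 1
    have "((\<lambda>t. poly (flat_poly j) (1 / t) * exp (- (1 / t))) has_real_derivative
        flat_deriv (Suc j) t) (at t)"
      using 1 by (auto intro!: derivative_eq_intros
        simp: flat_deriv_def poly_monom field_simps power2_eq_square)
    moreover have ev: "\<forall>\<^sub>F s in nhds t. poly (flat_poly j) (1 / s) * exp (- (1 / s)) = flat_deriv j s"
      using eventually_nhds_in_open[of "{0<..}" t] 1
      by (auto elim!: eventually_mono simp: flat_deriv_def)
    ultimately show ?thesis
      using DERIV_cong_ev[OF refl ev refl] by simp
  next
    case 2
    have ev: "\<forall>\<^sub>F s in nhds t. 0 = flat_deriv j s"
      using eventually_nhds_in_open[of "{..<0}" t] 2
      by (auto elim!: eventually_mono simp: flat_deriv_def)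
    moreover have "((\<lambda>t. 0) has_real_derivative flat_deriv (Suc j) t) (at t)"
      using 2 by (simp add: flat_deriv_def)
    ultimately show ?thesis
      using DERIV_cong_ev[OF refl ev refl] by simp
  next
    case 3
    \<comment> \<open>With \<open>x = 1 / h\<close> the right difference quotient at \<open>0\<close> is \<open>x p x / exp x\<close>.\<close>
    have "((\<lambda>x. poly (pCons 0 (flat_poly j)) x / exp x) \<longlongrightarrow> 0) at_top"
      by (rule poly_div_exp_tendsto_0)
    from filterlim_compose[OF this filterlim_inverse_at_top_right]
    have "((\<lambda>h. poly (pCons 0 (flat_poly j)) (inverse h) / exp (inverse h)) \<longlongrightarrow> 0) (at_right 0)" .
    then have "((\<lambda>h. flat_deriv j h / h) \<longlongrightarrow> 0) (at_right 0)"
      by (rule Lim_transform_eventually)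
         (auto simp: eventually_at_filter flat_deriv_def exp_minus field_simps)
    moreover have "((\<lambda>h. flat_deriv j h / h) \<longlongrightarrow> 0) (at_left 0)"
      by (rule Lim_transform_eventually[OF tendsto_const])
         (auto simp: eventually_at_filter flat_deriv_def)
    ultimately have "((\<lambda>h. flat_deriv j h / h) \<longlongrightarrow> 0) (at 0)"
      using filterlim_split_at by blast
    then show ?thesis
      using 3 by (simp add: DERIV_def flat_deriv_def)
  qed
qed

lemma flat_deriv_0_pos: "flat_deriv 0 t > 0 \<longleftrightarrow> t > 0" and flat_deriv_0_nonneg: "flat_deriv 0 t \<ge> 0"
  by (auto simp: flat_deriv_def)

text \<open>
  On \<open>[0, L]\<close> the first factor changes from nonpositive to nonnegative at \<open>p\<close> and the second
  from nonnegative to nonpositive at \<open>q\<close>. Shifting \<open>t\<close> by \<open>L\<close> changes the sign of both, so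
  the product has period \<open>L\<close> and can serve as the inner function of a periodic bump.
\<close>

lemma sin_mult_sin_pos_iff:
  fixes p q t :: real
  assumes "L > 0" "0 \<le> t" "t \<le> L" "0 \<le> p" "p < q" "q \<le> L"
  shows "sin (pi / L * t - pi / L * p) * sin (pi / L * q - pi / L * t) > 0 \<longleftrightarrow> p < t \<and> t < q"
proof -
  have pos: "sin (pi / L * x - pi / L * y) > 0" if "y < x" "x - y < L" for x y
  proof (rule sin_gt_zero)
    show "0 < pi / L * x - pi / L * y" using that assms by (simp add: divide_strict_right_mono)
    have "pi / L * (x - y) < pi / L * L" using that assms by (intro mult_strict_left_mono) auto
    then show "pi / L * x - pi / L * y < pi" using assms by (simp add: right_diff_distrib)
  qed
  have nonneg: "sin (pi / L * x - pi / L * y) \<ge> 0" if "y \<le> x" "x - y \<le> L" for x y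
  proof (rule sin_ge_zero)
    show "0 \<le> pi / L * x - pi / L * y" using that assms by (simp add: divide_right_mono)
    have "pi / L * (x - y) \<le> pi / L * L" using that assms by (intro mult_left_mono) auto
    then show "pi / L * x - pi / L * y \<le> pi" using assms by (simp add: right_diff_distrib)
  qed
  have neg: "sin (pi / L * y - pi / L * x) = - sin (pi / L * x - pi / L * y)" for x y
    using sin_minus[of "pi / L * x - pi / L * y"] by simp
  consider "t \<le> p" | "p < t" "t < q" | "q \<le> t" by linarith
  then show ?thesis
  proof cases
    case 1
    then have "0 \<le> sin (pi / L * p - pi / L * t)" "0 \<le> sin (pi / L * q - pi / L * t)"
      using assms by (intro nonneg; simp)+
    then show ?thesis using 1 neg[of t p] mult_nonneg_nonneg by (fastforce simp: not_less)
  next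
    case 2
    then show ?thesis using assms pos[of p t] pos[of t q] by simp
  next
    case 3
    then have "0 \<le> sin (pi / L * t - pi / L * p)" "0 \<le> sin (pi / L * t - pi / L * q)"
      using assms by (intro nonneg; simp)+
    then show ?thesis using 3 neg[of q t] mult_nonneg_nonneg by (fastforce simp: not_less)
  qed
qed

lemma Ck_sin: "Ck n h \<Longrightarrow> Ck n (\<lambda>x. sin (h x))"
proof -
  assume "Ck n h"
  have "((\<lambda>t. sin (t + real j * (pi / 2))) has_real_derivative sin (t + real (Suc j) * (pi / 2))) (at t)"
    for j t
  proof -
    have "sin (t + real (Suc j) * (pi / 2)) = sin ((t + real j * (pi / 2)) + pi / 2)"
      by (simp add: algebra_simps add_divide_distrib)
    also have "\<dots> = cos (t + real j * (pi / 2))"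
      by (simp only: sin_add) simp
    finally show ?thesis by (auto intro!: derivative_eq_intros)
  qed
  from Ck_compose[of "\<lambda>j t. sin (t + real j * (pi / 2))", OF this \<open>Ck n h\<close>, of 0]
  show ?thesis by simp
qed

lemma Ck_exp: "Ck n h \<Longrightarrow> Ck n (\<lambda>x. exp (h x))"
  using Ck_compose[of "\<lambda>j t. exp t"] DERIV_exp by blast

text \<open>
  Composing a flat function with a trigonometric polynomial that is positive exactly on the
  interval, modulo the period, gives a smooth bump without any gluing of periodic copies.
\<close>

lemma periodic_bump_exists:
  assumes box: "\<forall>l. a $ l < b $ l"
    and sub: "\<And>l. a $ l \<le> u $ l" "\<And>l. u $ l < v $ l" "\<And>l. v $ l \<le> b $ l"
  obtains h where "h \<in> test_scalar a b" "\<And>x. h x \<ge> 0"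
    "\<And>x. x \<in> cbox a b \<Longrightarrow> h x > 0 \<longleftrightarrow> x \<in> box u v"
proof -
  define w where "w l = pi / (b $ l - a $ l)" for l
  define g where "g l x = sin (w l * x $ l - w l * u $ l) * sin (w l * v $ l - w l * x $ l)"
    for l and x :: "real^3"
  define h where "h x = (\<Prod>l\<in>UNIV. flat_deriv 0 (g l x))" for x
  have w: "w l * (b $ l - a $ l) = pi" for l using box[rule_format, of l] by (simp add: w_def)
  have "Ck n (g l)" for n l
    unfolding g_def
    by (intro Ck_mult Ck_sin Ck_diff Ck_const Ck_component)
  then have Ck: "Ck n h" for n
    unfolding h_def by (intro Ck_prod Ck_compose[where F = flat_deriv] flat_deriv_has_derivative)
  have per: "g m (x + (b $ l - a $ l) *\<^sub>R axis l 1) = g m x" for m l x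
  proof (cases "m = l")
    case True
    have e: "w l * (x $ l + (b $ l - a $ l)) - w l * u $ l = (w l * x $ l - w l * u $ l) + pi"
      "w l * v $ l - w l * (x $ l + (b $ l - a $ l)) = (w l * v $ l - w l * x $ l) - pi"
      using w[of l] by (simp_all add: algebra_simps)
    have "sin (w l * (x $ l + (b $ l - a $ l)) - w l * u $ l) = - sin (w l * x $ l - w l * u $ l)"
      "sin (w l * v $ l - w l * (x $ l + (b $ l - a $ l))) = - sin (w l * v $ l - w l * x $ l)"
      unfolding e by (simp_all only: sin_periodic_pi sin_diff[of _ pi] sin_pi cos_pi)
    moreover have "(x + (b $ l - a $ l) *\<^sub>R axis l 1) $ l = x $ l + (b $ l - a $ l)" by simp
    ultimately show ?thesis unfolding True g_def by simp
  qed (simp add: g_def axis_def)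
  have "h \<in> test_scalar a b"
    using Ck per by (simp add: test_scalar_def h_def)
  moreover have "h x \<ge> 0" for x
    by (simp add: h_def prod_nonneg flat_deriv_0_nonneg)
  moreover have "h x > 0 \<longleftrightarrow> x \<in> box u v" if x: "x \<in> cbox a b" for x
  proof -
    have "h x > 0 \<longleftrightarrow> (\<forall>l. flat_deriv 0 (g l x) > 0)"
      using flat_deriv_0_nonneg
      by (auto simp: h_def order.strict_iff_order prod_nonneg)
    also have "\<dots> \<longleftrightarrow> (\<forall>l. u $ l < x $ l \<and> x $ l < v $ l)"
    proof -
      have "flat_deriv 0 (g l x) > 0 \<longleftrightarrow> u $ l < x $ l \<and> x $ l < v $ l" for l
      proof -
        have "g l x = sin (w l * (x $ l - a $ l) - w l * (u $ l - a $ l))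
            * sin (w l * (v $ l - a $ l) - w l * (x $ l - a $ l))"
          by (simp add: g_def algebra_simps)
        then show ?thesis
          using sin_mult_sin_pos_iff[of "b $ l - a $ l" "x $ l - a $ l" "u $ l - a $ l" "v $ l - a $ l"]
            box[rule_format, of l] sub[of l] x
          by (auto simp: flat_deriv_0_pos w_def mem_box_cart)
      qed
      then show ?thesis by blast
    qed
    also have "\<dots> \<longleftrightarrow> x \<in> box u v" by (simp add: mem_box_cart)
    finally show ?thesis .
  qed
  ultimately show thesis using that by blast
qed

text \<open>
  For a bump \<open>h\<close> the functions \<open>1 - exp (- n h)\<close> stay in \<open>[0, 1]\<close>, vanish where \<open>h\<close> does and tend
  to \<open>1\<close> where \<open>h > 0\<close>.
\<close>

lemma test_functions_approximating_box:
  assumes box: "\<forall>l. a $ l < b $ l"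
    and sub: "\<And>l. a $ l \<le> u $ l" "\<And>l. u $ l < v $ l" "\<And>l. v $ l \<le> b $ l"
  obtains \<psi> :: "nat \<Rightarrow> real^3 \<Rightarrow> real" where "\<And>n. \<psi> n \<in> test_scalar a b"
    "\<And>n x. 0 \<le> \<psi> n x" "\<And>n x. \<psi> n x \<le> 1"
    "\<And>n x. x \<in> cbox a b - box u v \<Longrightarrow> \<psi> n x = 0"
    "\<And>x. x \<in> cbox a b \<Longrightarrow> (\<lambda>n. \<psi> n x) \<longlonglongrightarrow> indicator (box u v) x"
proof -
  obtain h where h: "h \<in> test_scalar a b" "\<And>x. h x \<ge> 0"
    "\<And>x. x \<in> cbox a b \<Longrightarrow> h x > 0 \<longleftrightarrow> x \<in> box u v"
    using periodic_bump_exists[OF box sub] by blast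
  define \<psi> where "\<psi> n x = 1 - exp (- real n * h x)" for n x
  have "Ck m (\<psi> n)" for m n
    unfolding \<psi>_def
    by (intro Ck_diff Ck_exp Ck_mult Ck_const test_scalar_Ck[OF h(1)])
  then have 1: "\<psi> n \<in> test_scalar a b" for n
    using test_scalar_periodic[OF h(1)] by (simp add: test_scalar_def \<psi>_def)
  have 2: "\<psi> n x = 0" if "x \<in> cbox a b - box u v" for n x
  proof -
    have "h x = 0" using h(2)[of x] h(3)[of x] that by auto
    then show ?thesis by (simp add: \<psi>_def)
  qed
  have 3: "(\<lambda>n. \<psi> n x) \<longlonglongrightarrow> indicator (box u v) x" if x: "x \<in> cbox a b" for x
  proof (cases "x \<in> box u v")
    case True
    then have "exp (- h x) < 1" using h(3)[OF x] by simp
    then have "(\<lambda>n. exp (- h x) ^ n) \<longlonglongrightarrow> 0" by (intro LIMSEQ_realpow_zero) auto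
    from tendsto_diff[OF tendsto_const[of 1] this]
    have "(\<lambda>n. 1 - exp (- h x) ^ n) \<longlonglongrightarrow> 1" by simp
    moreover have "\<psi> n x = 1 - exp (- h x) ^ n" for n
      by (simp add: \<psi>_def flip: exp_of_nat_mult)
    ultimately show ?thesis using True by (simp only: indicator_simps)
  next
    case False
    then show ?thesis using 2 x by simp
  qed
  show thesis
    by (rule that[of \<psi>]) (use 1 2 3 h(2) in \<open>auto simp: \<psi>_def\<close>)
qed

lemma AE_lebesgue_on_iff_negligible:
  fixes S :: "(real^3) set"
  assumes "S \<in> sets lebesgue"
  shows "(AE x in lebesgue_on S. P x) \<longleftrightarrow> negligible {x\<in>S. \<not> P x}"
proof -
  have "(AE x in lebesgue_on S. P x) \<longleftrightarrow> (AE x in lebesgue. x \<in> S \<longrightarrow> P x)"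
    using assms by (simp add: AE_restrict_space_iff)
  also have "\<dots> \<longleftrightarrow> (\<exists>N. negligible N \<and> {x. \<not> (x \<in> S \<longrightarrow> P x)} \<subseteq> N)"
    by (auto simp: eventually_ae_filter negligible_iff_null_sets)
  also have "\<dots> \<longleftrightarrow> negligible {x\<in>S. \<not> P x}"
    using negligible_subset by (auto intro!: exI[of _ "{x\<in>S. \<not> P x}"])
  finally show ?thesis .
qed

lemma integrable_lebesgue_on_subset:
  fixes f :: "real^3 \<Rightarrow> real"
  assumes "integrable (lebesgue_on S) f" "U \<subseteq> S" "S \<in> sets lebesgue" "U \<in> sets lebesgue"
  shows "integrable (lebesgue_on U) f"
  using assms set_integrable_subset[of lebesgue S f U]
  by (simp add: integrable_restrict_space set_integrable_def)

text \<open>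
  Bumps exhaust the indicator of every subbox, so all integrals of \<open>f\<close> over subboxes vanish,
  and Lebesgue's differentiation theorem recovers \<open>f\<close> from them.
\<close>

lemma fundamental_lemma_on_subbox:
  assumes box: "\<forall>l. a $ l < b $ l"
    and sub: "\<And>l. a $ l \<le> u $ l" "\<And>l. u $ l < v $ l" "\<And>l. v $ l \<le> b $ l"
    and f: "integrable (lebesgue_on (box a b)) f"
    and zero: "\<And>\<psi>. \<psi> \<in> test_scalar a b \<Longrightarrow> \<forall>x\<in>cbox a b - box u v. \<psi> x = 0 \<Longrightarrow>
       (LINT x|lebesgue_on (box a b). f x * \<psi> x) = 0"
  shows "AE x in lebesgue_on (box u v). f x = (0::real)"
proof -
  have uv_ab: "box u v \<subseteq> box a b"
    using sub by (auto simp: mem_box_cart) (meson less_le_trans le_less_trans)+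
  have cell: "integral (cbox p q) f = 0"
    if "\<And>l. u $ l \<le> p $ l" "\<And>l. p $ l < q $ l" "\<And>l. q $ l \<le> v $ l" for p q
  proof -
    have pq_uv: "box p q \<subseteq> box u v"
      using that by (auto simp: mem_box_cart) (meson less_le_trans le_less_trans)+
    have sub': "\<And>l. a $ l \<le> p $ l" "\<And>l. p $ l < q $ l" "\<And>l. q $ l \<le> b $ l"
      using that sub order.trans by blast+
    from test_functions_approximating_box[OF box sub'] obtain \<psi> :: "nat \<Rightarrow> real^3 \<Rightarrow> real"
      where \<psi>: "\<And>n. \<psi> n \<in> test_scalar a b" "\<And>n x. 0 \<le> \<psi> n x" "\<And>n x. \<psi> n x \<le> 1"
        "\<And>n x. x \<in> cbox a b - box p q \<Longrightarrow> \<psi> n x = 0"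
        "\<And>x. x \<in> cbox a b \<Longrightarrow> (\<lambda>n. \<psi> n x) \<longlonglongrightarrow> indicator (box p q) x"
      by metis
    have meas: "\<psi> n \<in> borel_measurable (lebesgue_on (box a b))" for n
      using test_scalar_continuous[OF \<psi>(1)] by (intro continuous_imp_measurable_on_sets_lebesgue) auto
    have "(\<lambda>n. LINT x|lebesgue_on (box a b). f x * \<psi> n x)
        \<longlonglongrightarrow> (LINT x|lebesgue_on (box a b). f x * indicator (box p q) x)"
    proof (rule integral_dominated_convergence[where w = "\<lambda>x. \<bar>f x\<bar>"])
      show "(\<lambda>x. f x * indicator (box p q) x) \<in> borel_measurable (lebesgue_on (box a b))"
        using borel_measurable_integrable[OF f]
          pq_uv uv_ab
        by (intro borel_measurable_times borel_measurable_indicator) (auto simp: sets_restrict_space_iff)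
      show "(\<lambda>x. f x * \<psi> n x) \<in> borel_measurable (lebesgue_on (box a b))" for n
        using borel_measurable_integrable[OF f] meas by measurable
      show "integrable (lebesgue_on (box a b)) (\<lambda>x. \<bar>f x\<bar>)" using f by simp
      show "AE x in lebesgue_on (box a b). (\<lambda>n. f x * \<psi> n x) \<longlonglongrightarrow> f x * indicator (box p q) x"
        using \<psi>(5) box_subset_cbox by (intro AE_I2 tendsto_intros) (auto simp: space_restrict_space)
      show "AE x in lebesgue_on (box a b). norm (f x * \<psi> n x) \<le> \<bar>f x\<bar>" for n
        using \<psi>(2,3) by (intro AE_I2) (simp add: abs_mult mult_left_le)
    qed
    moreover have "(LINT x|lebesgue_on (box a b). f x * \<psi> n x) = 0" for n
      using \<psi>(1,4) pq_uv by (intro zero) auto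
    ultimately have "(LINT x|lebesgue_on (box a b). f x * indicator (box p q) x) = 0"
      using LIMSEQ_unique[OF _ tendsto_const] by simp
    moreover have "(LINT x|lebesgue_on (box a b). f x * indicator (box p q) x)
        = (LINT x|lebesgue_on (box p q). f x)"
      using subsetD[OF uv_ab subsetD[OF pq_uv]]
      by (auto simp: integral_restrict_space indicator_def intro!: Bochner_Integration.integral_cong)
    moreover have "integrable (lebesgue_on (box p q)) f"
      using integrable_lebesgue_on_subset[OF f order.trans[OF pq_uv uv_ab]] by simp
    ultimately have "integral (box p q) f = 0"
      by (simp add: lebesgue_integral_eq_integral)
    then show ?thesis by (simp add: integral_open_interval)
  qed
  define g where "g x = (if x \<in> box u v then f x else 0)" for x
  have "integrable (lebesgue_on (box u v)) f"
    using integrable_lebesgue_on_subset[OF f uv_ab] by simp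
  then have "f integrable_on box u v"
    by (simp add: integrable_on_lebesgue_on)
  then have "g integrable_on UNIV"
    unfolding g_def by (simp add: integrable_restrict_UNIV)
  then have "g integrable_on cbox p q" for p q
    using integrable_on_subcbox by blast
  then obtain N where N: "negligible N"
    "\<And>x e. x \<notin> N \<Longrightarrow> 0 < e \<Longrightarrow> \<exists>d>0. \<forall>h. 0 < h \<and> h < d \<longrightarrow>
        norm (integral (cbox x (x + h *\<^sub>R One)) g /\<^sub>R h ^ DIM(real^3) - g x) < e"
    using integrable_ccontinuous_explicit[of g] by metis
  have "f x = 0" if x: "x \<in> box u v" "x \<notin> N" for x
  proof (rule ccontr)
    assume "f x \<noteq> 0"
    then obtain d where d: "d > 0" "\<And>h. 0 < h \<Longrightarrow> h < d \<Longrightarrow>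
        norm (integral (cbox x (x + h *\<^sub>R One)) g /\<^sub>R h ^ DIM(real^3) - g x) < \<bar>f x\<bar>"
      using N(2)[OF x(2), of "\<bar>f x\<bar>"] by auto
    define h where "h = min (d / 2) (Min (range (\<lambda>l. (v $ l - x $ l) / 2)))"
    have hl: "h \<le> (v $ l - x $ l) / 2" for l
    proof -
      have "Min (range (\<lambda>l. (v $ l - x $ l) / 2)) \<le> (v $ l - x $ l) / 2" by (rule Min_le) auto
      then show ?thesis unfolding h_def by linarith
    qed
    have xv: "u $ l < x $ l" "x $ l < v $ l" for l using x by (auto simp: mem_box_cart)
    have h: "0 < h" "h < d" using d xv by (auto simp: h_def)
    have One: "(x + h *\<^sub>R One) $ l = x $ l + h" for l
    proof -
      have "(One :: real^3) $ l = 1"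
        using inner_sum_left_Basis[of "axis l 1 :: real^3" "\<lambda>_. 1"]
        by (simp add: cart_eq_inner_axis axis_in_Basis_iff)
      then show ?thesis by (simp add: cart_eq_inner_axis inner_simps)
    qed
    have "integral (cbox x (x + h *\<^sub>R One)) g = integral (cbox x (x + h *\<^sub>R One)) f"
    proof (rule integral_cong)
      fix y assume "y \<in> cbox x (x + h *\<^sub>R One)"
      then have y: "x $ l \<le> y $ l" "y $ l \<le> x $ l + h" for l
        unfolding mem_box_cart One by auto
      have "u $ l < y $ l \<and> y $ l < v $ l" for l
        using y[of l] xv[of l] hl[of l] by (simp add: field_simps)
      then show "g y = f y" by (simp add: g_def mem_box_cart)
    qed
    also have "\<dots> = 0"
    proof (rule cell)
      fix l
      show "u $ l \<le> x $ l" using xv[of l] by simp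
      show "x $ l < (x + h *\<^sub>R One) $ l" "(x + h *\<^sub>R One) $ l \<le> v $ l"
        unfolding One using h(1) hl[of l] xv[of l] by (simp_all add: field_simps)
    qed
    finally show False using d(2)[OF h] x by (simp add: g_def)
  qed
  then have "{x \<in> box u v. f x \<noteq> 0} \<subseteq> N" by auto
  then show ?thesis
    using N(1) negligible_subset by (auto simp: AE_lebesgue_on_iff_negligible)
qed

section \<open>Square-integrable functions and uniqueness of weak derivatives\<close>

lemma L2_integrable_inner:
  fixes f g :: "real^3 \<Rightarrow> 'v::euclidean_space"
  assumes "f \<in> L2 a b" "g \<in> L2 a b"
  shows "integrable (lebesgue_on (box a b)) (\<lambda>x. f x \<bullet> g x)"
proof (rule Bochner_Integration.integrable_bound)
  show "integrable (lebesgue_on (box a b)) (\<lambda>x. (norm (f x))\<^sup>2 + (norm (g x))\<^sup>2)"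
    using assms by (intro Bochner_Integration.integrable_add) (simp_all add: L2_def)
  show "(\<lambda>x. f x \<bullet> g x) \<in> borel_measurable (lebesgue_on (box a b))"
    using assms by (intro borel_measurable_inner) (simp_all add: L2_def)
  have "\<bar>f x \<bullet> g x\<bar> \<le> (norm (f x))\<^sup>2 + (norm (g x))\<^sup>2" for x
  proof -
    have "\<bar>f x \<bullet> g x\<bar> \<le> norm (f x) * norm (g x)" by (rule Cauchy_Schwarz_ineq2)
    also have "\<dots> \<le> 2 * norm (f x) * norm (g x)" by simp
    also have "\<dots> \<le> (norm (f x))\<^sup>2 + (norm (g x))\<^sup>2" by (rule sum_squares_bound)
    finally show ?thesis .
  qed
  then show "AE x in lebesgue_on (box a b). norm (f x \<bullet> g x) \<le> norm ((norm (f x))\<^sup>2 + (norm (g x))\<^sup>2)"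
    by simp
qed

lemma L2_add:
  fixes f g :: "real^3 \<Rightarrow> 'v::euclidean_space"
  assumes "f \<in> L2 a b" "g \<in> L2 a b"
  shows "(\<lambda>x. f x + g x) \<in> L2 a b"
proof -
  have "(norm (f x + g x))\<^sup>2 = (norm (f x))\<^sup>2 + 2 * (f x \<bullet> g x) + (norm (g x))\<^sup>2" for x
    by (simp add: power2_norm_eq_inner inner_add inner_commute)
  moreover have "integrable (lebesgue_on (box a b)) (\<lambda>x. (norm (f x))\<^sup>2 + 2 * (f x \<bullet> g x) + (norm (g x))\<^sup>2)"
    using assms L2_integrable_inner[OF assms]
    by (intro Bochner_Integration.integrable_add integrable_mult_right) (simp_all add: L2_def)
  moreover have "(\<lambda>x. f x + g x) \<in> borel_measurable (lebesgue_on (box a b))"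
    using assms by (intro borel_measurable_add) (simp_all add: L2_def)
  ultimately show ?thesis by (simp add: L2_def)
qed

lemma L2_scaleR:
  fixes f :: "real^3 \<Rightarrow> 'v::euclidean_space"
  assumes "f \<in> L2 a b"
  shows "(\<lambda>x. r *\<^sub>R f x) \<in> L2 a b"
  using assms by (auto simp: L2_def power_mult_distrib)

lemma L2_diff:
  fixes f g :: "real^3 \<Rightarrow> 'v::euclidean_space"
  assumes "f \<in> L2 a b" "g \<in> L2 a b"
  shows "(\<lambda>x. f x - g x) \<in> L2 a b"
  using L2_add[OF assms(1) L2_scaleR[OF assms(2), of "-1"]] by simp

lemma L2_component:
  fixes f :: "real^3 \<Rightarrow> real^3"
  assumes "f \<in> L2 a b"
  shows "(\<lambda>x. f x $ l) \<in> L2 a b"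
proof -
  have m: "(\<lambda>x. f x $ l) \<in> borel_measurable (lebesgue_on (box a b))"
  proof -
    have "(\<lambda>x. f x \<bullet> axis l 1) \<in> borel_measurable (lebesgue_on (box a b))"
      using assms by (intro borel_measurable_inner) (simp_all add: L2_def)
    then show ?thesis by (simp add: inner_axis)
  qed
  moreover have "integrable (lebesgue_on (box a b)) (\<lambda>x. (norm (f x $ l))\<^sup>2)"
  proof (rule Bochner_Integration.integrable_bound)
    show "integrable (lebesgue_on (box a b)) (\<lambda>x. (norm (f x))\<^sup>2)" using assms by (simp add: L2_def)
    show "(\<lambda>x. (norm (f x $ l))\<^sup>2) \<in> borel_measurable (lebesgue_on (box a b))" using m by simp
    show "AE x in lebesgue_on (box a b). norm ((norm (f x $ l))\<^sup>2) \<le> norm ((norm (f x))\<^sup>2)"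
      using component_le_norm_cart[of "f _" l] by (auto intro!: AE_I2 power_mono simp: abs_le_square_iff[symmetric])
  qed
  ultimately show ?thesis by (simp add: L2_def)
qed

lemma L2_axis:
  fixes f :: "real^3 \<Rightarrow> real"
  assumes "f \<in> L2 a b"
  shows "(\<lambda>x. axis l (f x) :: real^3) \<in> L2 a b"
proof -
  have "(\<lambda>x. axis l (f x) :: real^3) = (\<lambda>x. f x *\<^sub>R axis l 1)"
    by (simp add: fun_eq_iff vec_eq_iff axis_def)
  then show ?thesis
    using assms by (auto simp: L2_def power_mult_distrib intro!: borel_measurable_scaleR)
qed

lemma L2_from_components:
  fixes f :: "real^3 \<Rightarrow> real^3"
  assumes "\<And>l. (\<lambda>x. f x $ l) \<in> L2 a b"
  shows "f \<in> L2 a b"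
proof -
  have "f = (\<lambda>x. axis 1 (f x $ 1) + axis 2 (f x $ 2) + axis 3 (f x $ 3))"
    by (simp add: fun_eq_iff vec_eq_iff axis_def forall_3)
  also have "\<dots> \<in> L2 a b" by (intro L2_add L2_axis assms)
  finally show ?thesis .
qed

lemma finite_measure_box: "finite_measure (lebesgue_on (box a b :: (real^3) set))"
  by (rule finite_measure_lebesgue_on) simp

lemma L2_bounded:
  fixes f :: "real^3 \<Rightarrow> 'v::euclidean_space"
  assumes m: "f \<in> borel_measurable (lebesgue_on (box a b))"
    and bound: "\<And>x. x \<in> box a b \<Longrightarrow> norm (f x) \<le> M"
  shows "f \<in> L2 a b"
proof -
  interpret finite_measure "lebesgue_on (box a b)" by (rule finite_measure_box)
  have "integrable (lebesgue_on (box a b)) (\<lambda>x. (norm (f x))\<^sup>2)"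
  proof (rule integrable_const_bound[where B = "M\<^sup>2"])
    show "AE x in lebesgue_on (box a b). norm ((norm (f x))\<^sup>2) \<le> M\<^sup>2"
      using bound by (intro AE_I2) (auto intro!: power_mono)
    show "(\<lambda>x. (norm (f x))\<^sup>2) \<in> borel_measurable (lebesgue_on (box a b))" using m by simp
  qed
  then show ?thesis using m by (simp add: L2_def)
qed

lemma L2_continuous:
  fixes f :: "real^3 \<Rightarrow> 'v::euclidean_space"
  assumes "continuous_on (cbox a b) f"
  shows "f \<in> L2 a b"
proof -
  have "bounded (f ` cbox a b)"
    using compact_continuous_image[OF assms compact_cbox] by (rule compact_imp_bounded)
  then obtain M where "\<And>x. x \<in> cbox a b \<Longrightarrow> norm (f x) \<le> M"
    by (auto simp: bounded_iff)
  moreover have "f \<in> borel_measurable (lebesgue_on (box a b))"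
    using continuous_on_subset[OF assms box_subset_cbox]
    by (intro continuous_imp_measurable_on_sets_lebesgue) auto
  ultimately show ?thesis using box_subset_cbox by (intro L2_bounded[where M = M]) auto
qed

lemma L2_zero [simp]: "(\<lambda>x. 0) \<in> L2 a b"
  by (rule L2_continuous) simp

lemma L2_integrable:
  fixes f :: "real^3 \<Rightarrow> real"
  assumes "f \<in> L2 a b"
  shows "integrable (lebesgue_on (box a b)) f"
  using L2_integrable_inner[OF assms L2_continuous[of a b "\<lambda>x. 1"]] by simp

lemma L2_test_scalar: "\<psi> \<in> test_scalar a b \<Longrightarrow> \<psi> \<in> L2 a b"
  by (intro L2_continuous test_scalar_continuous)

lemma L2_test_vector: "\<psi> \<in> test_vector a b \<Longrightarrow> \<psi> \<in> L2 a b"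
  by (intro L2_from_components L2_test_scalar test_vector_component)

lemma L2_inner_add_left:
  fixes f g h :: "real^3 \<Rightarrow> 'v::euclidean_space"
  assumes "f \<in> L2 a b" "g \<in> L2 a b" "h \<in> L2 a b"
  shows "L2_inner a b (\<lambda>x. f x + g x) h = L2_inner a b f h + L2_inner a b g h"
  using assms by (simp add: L2_inner_def inner_add_left L2_integrable_inner)

lemma L2_inner_scaleR_left: "L2_inner a b (\<lambda>x. r *\<^sub>R f x) h = r * L2_inner a b f h"
  by (simp add: L2_inner_def)

lemma L2_inner_uminus_left: "L2_inner a b (\<lambda>x. - f x) h = - L2_inner a b f h"
  by (simp add: L2_inner_def)

lemma L2_inner_diff_left:
  fixes f g h :: "real^3 \<Rightarrow> 'v::euclidean_space"
  assumes "f \<in> L2 a b" "g \<in> L2 a b" "h \<in> L2 a b"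
  shows "L2_inner a b (\<lambda>x. f x - g x) h = L2_inner a b f h - L2_inner a b g h"
  using assms by (simp add: L2_inner_def inner_diff_left L2_integrable_inner)

lemma L2_inner_eq_0_AE:
  assumes "AE x in lebesgue_on (box a b). g x = 0"
  shows "L2_inner a b f g = 0"
  unfolding L2_inner_def by (rule integral_eq_zero_AE) (use assms in auto)

lemma L2_inner_self_eq_0:
  fixes f :: "real^3 \<Rightarrow> 'v::euclidean_space"
  assumes "f \<in> L2 a b" "L2_inner a b f f = 0"
  shows "AE x in lebesgue_on (box a b). f x = 0"
proof -
  have "AE x in lebesgue_on (box a b). f x \<bullet> f x = 0"
    using integral_nonneg_eq_0_iff_AE[OF L2_integrable_inner[OF assms(1,1)]] assms(2)
    by (simp add: L2_inner_def)
  then show ?thesis by simp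
qed

lemma L2_inner_axis_right: "L2_inner a b f (\<lambda>x. axis l (\<psi> x)) = (LINT x|lebesgue_on (box a b). f x $ l * \<psi> x)"
  by (simp add: L2_inner_def inner_axis)

lemma L2_orthogonal_test_vectors_on_subbox:
  fixes f :: "real^3 \<Rightarrow> real^3"
  assumes box: "\<forall>l. a $ l < b $ l"
    and sub: "\<And>l. a $ l \<le> u $ l" "\<And>l. u $ l < v $ l" "\<And>l. v $ l \<le> b $ l"
    and f: "f \<in> L2 a b"
    and zero: "\<And>\<psi> l. \<psi> \<in> test_scalar a b \<Longrightarrow> \<forall>x\<in>cbox a b - box u v. \<psi> x = 0 \<Longrightarrow>
       (LINT x|lebesgue_on (box a b). f x $ l * \<psi> x) = 0"
  shows "AE x in lebesgue_on (box u v). f x = 0"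
proof -
  have "AE x in lebesgue_on (box u v). f x $ l = 0" for l
    by (rule fundamental_lemma_on_subbox[OF box sub])
       (use L2_integrable[OF L2_component[OF f]] zero in auto)
  then have "AE x in lebesgue_on (box u v). \<forall>l\<in>UNIV. f x $ l = 0"
    by (intro AE_finite_allI) auto
  then show ?thesis by (simp add: vec_eq_iff)
qed

lemma L2_orthogonal_test_vectors:
  assumes box: "\<forall>l. a $ l < b $ l"
    and f: "f \<in> L2 a b"
    and zero: "\<And>\<psi>. \<psi> \<in> test_vector a b \<Longrightarrow> L2_inner a b f \<psi> = 0"
  shows "AE x in lebesgue_on (box a b). f x = 0"
proof (rule L2_orthogonal_test_vectors_on_subbox[OF box _ _ _ f])
  fix \<psi> l assume "\<psi> \<in> test_scalar a b"
  from zero[OF test_vector_axis[OF this]]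
  show "(LINT x|lebesgue_on (box a b). f x $ l * \<psi> x) = 0"
    by (simp add: L2_inner_axis_right)
qed (use box in auto)

lemma has_weak_grad_unique_AE:
  assumes box: "\<forall>l. a $ l < b $ l"
    and "has_weak_grad a b w g" "has_weak_grad a b w g'"
  shows "AE x in lebesgue_on (box a b). g x = g' x"
proof -
  have L: "g \<in> L2 a b" "g' \<in> L2 a b" using assms by (auto simp: has_weak_grad_def)
  have "AE x in lebesgue_on (box a b). g x - g' x = 0"
  proof (rule L2_orthogonal_test_vectors[OF box L2_diff[OF L]])
    fix \<psi> assume "\<psi> \<in> test_vector a b"
    then show "L2_inner a b (\<lambda>x. g x - g' x) \<psi> = 0"
      using assms(2,3) L by (simp add: L2_inner_diff_left L2_test_vector has_weak_grad_def)
  qed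
  then show ?thesis by simp
qed

lemma has_weak_curl_unique_AE:
  assumes box: "\<forall>l. a $ l < b $ l"
    and "has_weak_curl a b w c" "has_weak_curl a b w c'"
  shows "AE x in lebesgue_on (box a b). c x = c' x"
proof -
  have L: "c \<in> L2 a b" "c' \<in> L2 a b" using assms by (auto simp: has_weak_curl_def)
  have "AE x in lebesgue_on (box a b). c x - c' x = 0"
  proof (rule L2_orthogonal_test_vectors[OF box L2_diff[OF L]])
    fix \<psi> assume "\<psi> \<in> test_vector a b"
    then show "L2_inner a b (\<lambda>x. c x - c' x) \<psi> = 0"
      using assms(2,3) L by (simp add: L2_inner_diff_left L2_test_vector has_weak_curl_def)
  qed
  then show ?thesis by simp
qed

lemma has_weak_curl_curl: "has_weak_curl a b w c \<Longrightarrow> has_weak_curl a b w (curl a b w)"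
  unfolding curl_def by (metis someI)

lemma has_weak_grad_grad: "has_weak_grad a b w g \<Longrightarrow> has_weak_grad a b w (grad a b w)"
  unfolding grad_def by (metis someI)

text \<open>
  The weak complex property is inherited from the test functions: the curl of a test vector
  is a divergence-free test vector, and the gradient of a test scalar is a curl-free one.
\<close>

lemma weak_grad_has_weak_curl_0:
  assumes "has_weak_grad a b w g"
  shows "has_weak_curl a b g (\<lambda>x. 0)"
proof -
  have "L2_inner a b g (classical_curl \<psi>) = 0" if "\<psi> \<in> test_vector a b" for \<psi>
  proof -
    have "L2_inner a b w (classical_div (classical_curl \<psi>)) = - L2_inner a b g (classical_curl \<psi>)"
      using assms classical_curl_test_vector[OF that] by (simp add: has_weak_grad_def)
    then show ?thesis by (simp add: L2_inner_def div_curl_test_vector[OF that])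
  qed
  then show ?thesis by (simp add: has_weak_curl_def) (simp add: L2_inner_def)
qed

lemma weak_curl_orthogonal_grad:
  assumes "has_weak_curl a b w c" "\<psi> \<in> test_scalar a b"
  shows "L2_inner a b c (classical_grad \<psi>) = 0"
proof -
  have "L2_inner a b w (classical_curl (classical_grad \<psi>)) = L2_inner a b c (classical_grad \<psi>)"
    using assms classical_grad_test_vector by (simp add: has_weak_curl_def)
  then show ?thesis by (simp add: L2_inner_def curl_grad_test_scalar[OF assms(2)])
qed

lemma weak_curl_has_weak_div_0:
  assumes "has_weak_curl a b w c"
  shows "has_weak_div a b c (\<lambda>x. 0)"
  using weak_curl_orthogonal_grad[OF assms] by (simp add: has_weak_div_def) (simp add: L2_inner_def)

lemma curl_grad_AE_0:
  assumes box: "\<forall>l. a $ l < b $ l" and g: "has_weak_grad a b w g"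
  shows "AE x in lebesgue_on (box a b). curl a b g x = 0"
  using has_weak_curl_unique_AE[OF box has_weak_curl_curl weak_grad_has_weak_curl_0[OF g]]
    weak_grad_has_weak_curl_0[OF g] by blast

section \<open>Polynomials of bounded degree in each variable\<close>

lemma Q_poly_zero: "(\<lambda>x. 0) \<in> Q_poly d1 d2 d3"
  by (auto simp: Q_poly_def intro!: exI[of _ "\<lambda>i j m. 0"])

lemma Q_poly_add:
  assumes "p \<in> Q_poly d1 d2 d3" "q \<in> Q_poly d1 d2 d3"
  shows "(\<lambda>x. p x + q x) \<in> Q_poly d1 d2 d3"
proof -
  obtain c where c: "p x = (\<Sum>i\<le>d1. \<Sum>j\<le>d2. \<Sum>m\<le>d3. c i j m * (x $ 1)^i * (x $ 2)^j * (x $ 3)^m)" for x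
    using assms(1) unfolding Q_poly_def by blast
  obtain c' where c': "q x = (\<Sum>i\<le>d1. \<Sum>j\<le>d2. \<Sum>m\<le>d3. c' i j m * (x $ 1)^i * (x $ 2)^j * (x $ 3)^m)" for x
    using assms(2) unfolding Q_poly_def by blast
  have "p x + q x = (\<Sum>i\<le>d1. \<Sum>j\<le>d2. \<Sum>m\<le>d3. (c i j m + c' i j m) * (x $ 1)^i * (x $ 2)^j * (x $ 3)^m)" for x
    unfolding c c' by (simp add: sum.distrib distrib_right)
  then show ?thesis
    unfolding Q_poly_def by (intro CollectI exI[of _ "\<lambda>i j m. c i j m + c' i j m"]) simp
qed

lemma Q_poly_cmult:
  assumes "p \<in> Q_poly d1 d2 d3"
  shows "(\<lambda>x. r * p x) \<in> Q_poly d1 d2 d3"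
proof -
  obtain c where c: "p x = (\<Sum>i\<le>d1. \<Sum>j\<le>d2. \<Sum>m\<le>d3. c i j m * (x $ 1)^i * (x $ 2)^j * (x $ 3)^m)" for x
    using assms unfolding Q_poly_def by blast
  have "r * p x = (\<Sum>i\<le>d1. \<Sum>j\<le>d2. \<Sum>m\<le>d3. (r * c i j m) * (x $ 1)^i * (x $ 2)^j * (x $ 3)^m)" for x
    unfolding c by (simp add: sum_distrib_left mult.assoc)
  then show ?thesis
    unfolding Q_poly_def by (intro CollectI exI[of _ "\<lambda>i j m. r * c i j m"]) simp
qed

lemma Q_poly_diff:
  assumes "p \<in> Q_poly d1 d2 d3" "q \<in> Q_poly d1 d2 d3"
  shows "(\<lambda>x. p x - q x) \<in> Q_poly d1 d2 d3"
  using Q_poly_add[OF assms(1) Q_poly_cmult[OF assms(2), of "-1"]] by simp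

lemma Q_poly_sum: "(\<And>i. i \<in> S \<Longrightarrow> p i \<in> Q_poly d1 d2 d3) \<Longrightarrow> (\<lambda>x. \<Sum>i\<in>S. p i x) \<in> Q_poly d1 d2 d3"
  by (induction S rule: infinite_finite_induct) (auto intro: Q_poly_zero Q_poly_add)

lemma Q_poly_monomial:
  assumes "i \<le> d1" "j \<le> d2" "m \<le> d3"
  shows "(\<lambda>x. r * (x $ 1)^i * (x $ 2)^j * (x $ 3)^m) \<in> Q_poly d1 d2 d3"
proof -
  define c where "c i' j' m' = (if i' = i then if j' = j then if m' = m then r else 0 else 0 else 0)"
    for i' j' m'
  have "(\<Sum>i\<le>d1. \<Sum>j\<le>d2. \<Sum>m\<le>d3. c i j m * (x $ 1)^i * (x $ 2)^j * (x $ 3)^m)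
      = r * (x $ 1)^i * (x $ 2)^j * (x $ 3)^m" for x :: "real^3"
  proof -
    have 1: "(\<Sum>m'\<le>d3. c i' j' m' * (x $ 1)^i' * (x $ 2)^j' * (x $ 3)^m')
        = (if i' = i then if j' = j then r * (x $ 1)^i * (x $ 2)^j * (x $ 3)^m else 0 else 0)" for i' j'
      using assms by (auto simp: c_def if_distribR if_distrib[of "\<lambda>y. y * _"] cong: if_cong)
    have 2: "(\<Sum>j'\<le>d2. \<Sum>m'\<le>d3. c i' j' m' * (x $ 1)^i' * (x $ 2)^j' * (x $ 3)^m')
        = (if i' = i then r * (x $ 1)^i * (x $ 2)^j * (x $ 3)^m else 0)" for i'
      using assms unfolding 1 by auto
    show ?thesis using assms unfolding 2 by auto
  qed
  then show ?thesis unfolding Q_poly_def by (intro CollectI exI[of _ c]) simp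
qed

text \<open>
  With the degrees given as a function of the variable, a partial derivative changes one value
  of that function, and statements about all three variables need no case distinction.
\<close>

definition Q_deg :: "(3 \<Rightarrow> nat) \<Rightarrow> (real^3 \<Rightarrow> real) set" where
  "Q_deg d = Q_poly (d 1) (d 2) (d 3)"

lemma monomial_derivative:
  fixes r :: real
  shows "((\<lambda>x :: real^3. r * (x $ 1)^i * (x $ 2)^j * (x $ 3)^m) has_derivative
    (\<lambda>v. r * real i * (x $ 1)^(i - 1) * (x $ 2)^j * (x $ 3)^m * v $ 1
       + r * real j * (x $ 1)^i * (x $ 2)^(j - 1) * (x $ 3)^m * v $ 2
       + r * real m * (x $ 1)^i * (x $ 2)^j * (x $ 3)^(m - 1) * v $ 3)) (at x)"
  by (auto intro!: derivative_eq_intros bounded_linear.has_derivative[OF bounded_linear_vec_nth]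
      simp: algebra_simps)

lemma Q_deg_differentiable_partial:
  assumes "p \<in> Q_deg d"
  shows "p differentiable at x" and "partial l p \<in> Q_deg (d(l := d l - 1))"
proof -
  let ?M = "\<lambda>c i j m (x :: real^3). c * (x $ 1)^i * (x $ 2)^j * (x $ 3)^m :: real"
  obtain c where c: "p x = (\<Sum>i\<le>d 1. \<Sum>j\<le>d 2. \<Sum>m\<le>d 3. ?M (c i j m) i j m x)" for x
    using assms unfolding Q_poly_def Q_deg_def by blast
  have D: "(p has_derivative (\<lambda>v. \<Sum>i\<le>d 1. \<Sum>j\<le>d 2. \<Sum>m\<le>d 3.
      frechet_derivative (?M (c i j m) i j m) (at x) v)) (at x)" for x
    unfolding c[abs_def]
    by (intro has_derivative_sum has_derivative_partial differentiableI[OF monomial_derivative])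
  then show "p differentiable at x" by (auto simp: differentiable_def)
  have "partial l (?M r i j m) \<in> Q_deg (d(l := d l - 1))" if "i \<le> d 1" "j \<le> d 2" "m \<le> d 3" for r i j m
  proof -
    have "partial l (?M r i j m) = (\<lambda>x. r * real i * (x $ 1)^(i - 1) * (x $ 2)^j * (x $ 3)^m * axis l 1 $ 1
       + r * real j * (x $ 1)^i * (x $ 2)^(j - 1) * (x $ 3)^m * axis l 1 $ 2
       + r * real m * (x $ 1)^i * (x $ 2)^j * (x $ 3)^(m - 1) * axis l 1 $ 3)"
      using partial_eqI[OF monomial_derivative] by blast
    moreover have "l = 1 \<or> l = 2 \<or> l = 3" by (rule exhaust_3)
    ultimately show ?thesis
      using that by (auto simp: Q_deg_def axis_def intro!: Q_poly_monomial)
  qed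
  then have "(\<lambda>x. \<Sum>i\<le>d 1. \<Sum>j\<le>d 2. \<Sum>m\<le>d 3. partial l (?M (c i j m) i j m) x) \<in> Q_deg (d(l := d l - 1))"
    unfolding Q_deg_def by (intro Q_poly_sum) auto
  moreover have "partial l p = (\<lambda>x. \<Sum>i\<le>d 1. \<Sum>j\<le>d 2. \<Sum>m\<le>d 3. partial l (?M (c i j m) i j m) x)"
    using partial_eqI[OF D] by (simp add: fun_eq_iff partial_def)
  ultimately show "partial l p \<in> Q_deg (d(l := d l - 1))" by simp
qed

lemma Q_deg_Ck: "p \<in> Q_deg d \<Longrightarrow> Ck n p"
proof (induction n arbitrary: p d)
  case 0
  then show ?case
    using Q_deg_differentiable_partial(1)[OF 0]
    by (simp add: continuous_at_imp_continuous_on differentiable_imp_continuous_within)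
next
  case (Suc n)
  then show ?case
    using Suc.IH[OF Q_deg_differentiable_partial(2)[OF Suc.prems]]
      Q_deg_differentiable_partial(1)[OF Suc.prems] by simp
qed

lemma Nedelec_poly_iff:
  "p \<in> Nedelec_poly k \<longleftrightarrow> (\<forall>l. (\<lambda>x. p x $ l) \<in> Q_deg ((\<lambda>m. k)(l := k - 1)))"
  by (simp add: Nedelec_poly_def Q_deg_def forall_3)

lemma RT_poly_iff:
  "p \<in> RT_poly k \<longleftrightarrow> (\<forall>l. (\<lambda>x. p x $ l) \<in> Q_deg ((\<lambda>m. k - 1)(l := k)))"
  by (simp add: RT_poly_def Q_deg_def forall_3)

text \<open>
  Both terms of component \<open>l\<close> of the curl differentiate, in one of the other two variables, a
  Nedelec component whose degree is already lowered in the remaining one. This leaves degree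
  \<open>k\<close> in variable \<open>l\<close> and \<open>k - 1\<close> in the other two, as for Raviart--Thomas polynomials.
\<close>

lemma curl_Nedelec_component:
  assumes "p \<in> Nedelec_poly k"
  shows "(\<lambda>x. partial (l + 1) (\<lambda>y. p y $ (l + 2)) x - partial (l + 2) (\<lambda>y. p y $ (l + 1)) x)
    \<in> Q_deg ((\<lambda>m. k - 1)(l := k))"
proof -
  have "l = 1 \<or> l = 2 \<or> l = 3" by (rule exhaust_3)
  then have deg: "((\<lambda>m. k)(l + 2 := k - 1))(l + 1 := ((\<lambda>m. k)(l + 2 := k - 1)) (l + 1) - 1)
        = (\<lambda>m. k - 1)(l := k)"
      "((\<lambda>m. k)(l + 1 := k - 1))(l + 2 := ((\<lambda>m. k)(l + 1 := k - 1)) (l + 2) - 1)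
        = (\<lambda>m. k - 1)(l := k)"
    unfolding fun_eq_iff forall_3
    by (elim disjE; hypsubst; simp only: index_3_add; simp)+
  have "partial (l + 1) (\<lambda>y. p y $ (l + 2)) \<in> Q_deg ((\<lambda>m. k - 1)(l := k))"
    "partial (l + 2) (\<lambda>y. p y $ (l + 1)) \<in> Q_deg ((\<lambda>m. k - 1)(l := k))"
    using assms[unfolded Nedelec_poly_iff, rule_format, THEN Q_deg_differentiable_partial(2), of "l + 2" "l + 1"]
      assms[unfolded Nedelec_poly_iff, rule_format, THEN Q_deg_differentiable_partial(2), of "l + 1" "l + 2"]
    unfolding deg by blast+
  then show ?thesis unfolding Q_deg_def by (rule Q_poly_diff)
qed

section \<open>Mesh cells and their reference map\<close>

definition cell_inv :: "(real^3) set \<Rightarrow> real^3 \<Rightarrow> real^3" where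
  "cell_inv K y = (\<chi> l. (y $ l - interval_lowerbound K $ l) / cell_width K $ l)"

lemma mesh_cell:
  assumes mesh: "conforming_mesh a b T" and K: "K \<in> T"
  shows "K = cbox (interval_lowerbound K) (interval_upperbound K)"
    and "interior K = box (interval_lowerbound K) (interval_upperbound K)"
    and "interval_lowerbound K $ l < interval_upperbound K $ l"
    and "cell_width K $ l > 0"
    and "a $ l \<le> interval_lowerbound K $ l"
    and "interval_upperbound K $ l \<le> b $ l"
proof -
  have div: "T division_of cbox a b" and int: "interior K \<noteq> {}"
    using assms by (simp_all add: conforming_mesh_def)
  then obtain u v where uv: "K = cbox u v"
    using division_ofD(4) K by metis
  have "box u v \<noteq> {}"
    using int unfolding uv by (simp only: interior_cbox not_False_eq_True)
  then have less: "u $ l < v $ l" for l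
    by (metis interval_ne_empty_cart(2))
  then have "cbox u v \<noteq> {}"
    by (simp add: interval_ne_empty_cart(1) less_imp_le)
  then have ub: "interval_upperbound K = v" and lb: "interval_lowerbound K = u"
    unfolding uv by (rule interval_bounds')+
  show "K = cbox (interval_lowerbound K) (interval_upperbound K)"
    and "interior K = box (interval_lowerbound K) (interval_upperbound K)"
    and "interval_lowerbound K $ l < interval_upperbound K $ l"
    and "cell_width K $ l > 0"
    using less by (simp_all add: ub lb cell_width_def) (simp_all add: uv)
  have "u \<in> cbox a b" "v \<in> cbox a b"
    using division_ofD(2)[OF div K] less by (auto simp: uv mem_box_cart less_imp_le subset_iff)
  then show "a $ l \<le> interval_lowerbound K $ l" "interval_upperbound K $ l \<le> b $ l"
    by (simp_all add: ub lb mem_box_cart)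
qed

lemma cell_map_cell_inv:
  assumes "conforming_mesh a b T" "K \<in> T"
  shows "cell_map K (cell_inv K y) = y" and "cell_inv K (cell_map K x) = x"
  using mesh_cell(4)[OF assms] by (simp_all add: vec_eq_iff cell_map_def cell_inv_def less_imp_neq[symmetric])

lemma cell_inv_in_ref_cell:
  assumes "conforming_mesh a b T" "K \<in> T" "y \<in> K"
  shows "cell_inv K y \<in> ref_cell"
proof -
  obtain x where "x \<in> ref_cell" "y = cell_map K x"
    using cell_map_image[OF assms(1,2)] assms(3) by blast
  then show ?thesis by (simp add: cell_map_cell_inv[OF assms(1,2)])
qed

lemma cell_inv_has_derivative:
  "(cell_inv K has_derivative (\<lambda>v. \<chi> l. v $ l / cell_width K $ l)) (at y)"
proof -
  have lin: "bounded_linear (\<lambda>v. \<chi> l. v $ l / cell_width K $ l)"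
    by (rule linear_conv_bounded_linear[THEN iffD1])
       (auto simp: linear_iff vec_eq_iff add_divide_distrib)
  have eq: "cell_inv K = (\<lambda>y. (\<chi> l. y $ l / cell_width K $ l)
      - (\<chi> l. interval_lowerbound K $ l / cell_width K $ l))"
    by (simp add: fun_eq_iff vec_eq_iff cell_inv_def diff_divide_distrib)
  show ?thesis
    unfolding eq by (auto intro!: derivative_eq_intros bounded_linear_imp_has_derivative[OF lin])
qed

lemma cell_map_differentiable: "cell_map K differentiable at x"
  and cell_inv_differentiable: "cell_inv K differentiable at x"
  by (rule differentiableI[OF cell_map_has_derivative], rule differentiableI[OF cell_inv_has_derivative])

lemma partial_compose_cell_inv:
  assumes "\<And>y. p differentiable at y"
  shows "(\<lambda>y. p (cell_inv K y)) differentiable at y"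
    and "partial l (\<lambda>y. p (cell_inv K y)) y = partial l p (cell_inv K y) / cell_width K $ l"
proof -
  have D: "((\<lambda>y. p (cell_inv K y)) has_derivative
      (\<lambda>v. frechet_derivative p (at (cell_inv K y)) (\<chi> l. v $ l / cell_width K $ l))) (at y)"
    by (rule has_derivative_compose[OF cell_inv_has_derivative has_derivative_partial[OF assms]])
  then show "(\<lambda>y. p (cell_inv K y)) differentiable at y" by (auto simp: differentiable_def)
  have "(\<chi> m. axis l 1 $ m / cell_width K $ m) = (1 / cell_width K $ l) *\<^sub>R axis l (1::real)"
    by (simp add: vec_eq_iff axis_def)
  then show "partial l (\<lambda>y. p (cell_inv K y)) y = partial l p (cell_inv K y) / cell_width K $ l"
    using partial_eqI[OF D, of l] linear_frechet_derivative[OF assms]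
    by (simp add: partial_def linear_scale)
qed

lemma continuous_on_cell_inv: "continuous_on S (cell_inv K)"
  by (simp add: cell_inv_differentiable continuous_at_imp_continuous_on differentiable_imp_continuous_within)

text \<open>
  Affine bijections preserve null sets, and the boundary of a cell is a null set. Hence
  statements on the reference cell, where the finite elements are defined, pass to the interior
  of the cell, where derivatives are taken, and back.
\<close>

lemma AE_ref_cell_iff:
  assumes mesh: "conforming_mesh a b T" and K: "K \<in> T"
  shows "(AE x in lebesgue_on ref_cell. P (cell_map K x)) \<longleftrightarrow> (AE y in lebesgue_on (interior K). P y)"
proof -
  note inv = cell_map_cell_inv[OF mesh K]
  have ref: "ref_cell \<in> sets lebesgue" by (simp add: ref_cell_def)
  have int: "interior K \<in> sets lebesgue" by (simp add: borel_open)
  have "negligible {y\<in>interior K. \<not> P y}" if "negligible {x\<in>ref_cell. \<not> P (cell_map K x)}"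
  proof (rule negligible_subset)
    show "negligible (cell_map K ` {x\<in>ref_cell. \<not> P (cell_map K x)})"
      using that cell_map_differentiable
      by (intro negligible_differentiable_image_negligible)
         (auto simp: differentiable_on_def intro: differentiable_at_withinI)
    show "{y\<in>interior K. \<not> P y} \<subseteq> cell_map K ` {x\<in>ref_cell. \<not> P (cell_map K x)}"
    proof
      fix y assume y: "y \<in> {y\<in>interior K. \<not> P y}"
      then have "cell_inv K y \<in> {x\<in>ref_cell. \<not> P (cell_map K x)}"
        using cell_inv_in_ref_cell[OF mesh K] interior_subset by (auto simp: inv)
      then have "cell_map K (cell_inv K y) \<in> cell_map K ` {x\<in>ref_cell. \<not> P (cell_map K x)}"
        by (rule imageI)
      then show "y \<in> cell_map K ` {x\<in>ref_cell. \<not> P (cell_map K x)}" by (simp only: inv)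
    qed
  qed
  moreover have "negligible {x\<in>ref_cell. \<not> P (cell_map K x)}" if "negligible {y\<in>interior K. \<not> P y}"
  proof (rule negligible_subset)
    have "negligible (K - interior K)"
      unfolding mesh_cell(2)[OF mesh K]
      by (subst mesh_cell(1)[OF mesh K]) (rule negligible_frontier_interval)
    then show "negligible (cell_inv K ` ({y\<in>interior K. \<not> P y} \<union> (K - interior K)))"
      using that cell_inv_differentiable
      by (intro negligible_differentiable_image_negligible)
         (auto simp: differentiable_on_def intro: differentiable_at_withinI)
    show "{x\<in>ref_cell. \<not> P (cell_map K x)} \<subseteq> cell_inv K ` ({y\<in>interior K. \<not> P y} \<union> (K - interior K))"
    proof
      fix x assume x: "x \<in> {x\<in>ref_cell. \<not> P (cell_map K x)}"
      then have "cell_map K x \<in> {y\<in>interior K. \<not> P y} \<union> (K - interior K)"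
        using cell_map_image[OF mesh K] by auto
      then show "x \<in> cell_inv K ` ({y\<in>interior K. \<not> P y} \<union> (K - interior K))"
        using imageI[of "cell_map K x" _ "cell_inv K"] by (simp only: inv)
    qed
  qed
  ultimately show ?thesis
    unfolding AE_lebesgue_on_iff_negligible[OF ref] AE_lebesgue_on_iff_negligible[OF int] by blast
qed

section \<open>Gradients of continuous piecewise polynomials\<close>

lemma mesh_finite: "conforming_mesh a b T \<Longrightarrow> finite T"
  by (auto simp: conforming_mesh_def)

lemma mesh_disjoint:
  assumes "conforming_mesh a b T" "K \<in> T" "L \<in> T" "x \<in> interior K" "x \<in> interior L"
  shows "K = L"
  using assms division_ofD(5)[of T "cbox a b" K L] by (auto simp: conforming_mesh_def)

text \<open>
  All cell boundaries are described by finitely many coordinate values: a point of the closed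
  box that lies in no cell interior has one of its coordinates in this set. It serves as the
  exceptional set of the integration along lines.
\<close>

definition mesh_coordinates :: "(real^3) set set \<Rightarrow> real set" where
  "mesh_coordinates T = (\<Union>K\<in>T. range (\<lambda>l. interval_lowerbound K $ l) \<union> range (\<lambda>l. interval_upperbound K $ l))"

lemma finite_mesh_coordinates: "conforming_mesh a b T \<Longrightarrow> finite (mesh_coordinates T)"
  by (auto simp: mesh_coordinates_def mesh_finite)

lemma in_cell_interior:
  assumes mesh: "conforming_mesh a b T" and x: "x \<in> cbox a b" "\<forall>m. x $ m \<notin> mesh_coordinates T"
  obtains K where "K \<in> T" "x \<in> interior K"
proof -
  have "\<Union>T = cbox a b" using mesh by (auto simp: conforming_mesh_def)
  then obtain K where K: "K \<in> T" "x \<in> K" using x by blast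
  have "interval_lowerbound K $ m < x $ m \<and> x $ m < interval_upperbound K $ m" for m
  proof -
    have "interval_lowerbound K $ m \<in> mesh_coordinates T" "interval_upperbound K $ m \<in> mesh_coordinates T"
      using K by (auto simp: mesh_coordinates_def)
    then have "interval_lowerbound K $ m \<noteq> x $ m" "interval_upperbound K $ m \<noteq> x $ m"
      using x by metis+
    moreover have "x \<in> cbox (interval_lowerbound K) (interval_upperbound K)"
      using K mesh_cell(1)[OF mesh K(1)] by blast
    ultimately show ?thesis by (simp add: mem_box_cart order.strict_iff_order)
  qed
  then have "x \<in> interior K"
    unfolding mesh_cell(2)[OF mesh K(1)] by (simp add: mem_box_cart)
  with K show thesis using that by blast
qed

lemma interior_cell_subset_box: "conforming_mesh a b T \<Longrightarrow> K \<in> T \<Longrightarrow> interior K \<subseteq> box a b"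
  using division_ofD(2)[of T "cbox a b" K] interior_mono[of K "cbox a b"]
  by (auto simp: conforming_mesh_def)

text \<open>
  The classical gradients on the cells glue to a weak gradient: continuity across the cells
  and periodicity leave no boundary terms on the lines along an axis.
\<close>

lemma V_space_weak_grad:
  assumes box: "\<forall>l. a $ l < b $ l" and mesh: "conforming_mesh a b T"
    and w: "w \<in> V_space a b T k"
    and p: "\<And>K. K \<in> T \<Longrightarrow> p K \<in> Q_poly k k k"
      "\<And>K x. K \<in> T \<Longrightarrow> x \<in> ref_cell \<Longrightarrow> w (cell_map K x) = p K x"
  obtains g where "has_weak_grad a b w g"
    "\<And>K x. K \<in> T \<Longrightarrow> x \<in> interior K \<Longrightarrow> g x = classical_grad (\<lambda>y. p K (cell_inv K y)) x"
proof -
  define P where "P K y = p K (cell_inv K y)" for K y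
  have Q: "p K \<in> Q_deg (\<lambda>_. k)" if "K \<in> T" for K using p(1)[OF that] by (simp add: Q_deg_def)
  have diff_p: "p K differentiable at y" if "K \<in> T" for K y
    using Q_deg_differentiable_partial(1)[OF Q[OF that]] .
  have diff_P: "P K differentiable at y"
    and partial_P: "partial l (P K) y = partial l (p K) (cell_inv K y) / cell_width K $ l"
    if "K \<in> T" for K l y
    unfolding P_def by (rule partial_compose_cell_inv[OF diff_p[OF that]])+
  have cont_P: "continuous_on UNIV (partial l (P K))" if "K \<in> T" for K l
  proof -
    have "continuous_on UNIV (partial l (p K))"
      using Q_deg_Ck[OF Q[OF that], of 1] by simp
    then have "continuous_on UNIV (\<lambda>y. partial l (p K) (cell_inv K y))"
      using continuous_on_cell_inv by (rule continuous_on_compose2) auto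
    then show ?thesis
      using mesh_cell(4)[OF mesh that, of l] partial_P[OF that]
      by (auto intro!: continuous_intros cong: continuous_on_cong)
  qed
  have w_eq: "w y = P K y" if "K \<in> T" "y \<in> K" for K y
    using p(2)[OF that(1) cell_inv_in_ref_cell[OF mesh that]] cell_map_cell_inv(1)[OF mesh that(1)]
    by (simp add: P_def)
  have w_cont: "continuous_on (cbox a b) w"
    and w_per: "\<And>l x. x \<in> cbox a b \<Longrightarrow> x $ l = a $ l \<Longrightarrow> w (x + (b $ l - a $ l) *\<^sub>R axis l 1) = w x"
    using w by (auto simp: V_space_def)
  define g :: "real^3 \<Rightarrow> real^3" where
    "g x = (\<chi> l. \<Sum>K\<in>T. indicator (interior K) x * partial l (P K) x)" for x
  have fin: "finite T" using mesh_finite[OF mesh] .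
  have g_eq: "g x = classical_grad (P K) x" if "K \<in> T" "x \<in> interior K" for K x
  proof -
    have ind: "indicator (interior L) x = (if L = K then 1 else 0 :: real)" if "L \<in> T" for L
    proof (cases "L = K")
      case False
      then have "x \<notin> interior L"
        using mesh_disjoint[OF mesh that \<open>K \<in> T\<close> _ \<open>x \<in> interior K\<close>] by blast
      with False show ?thesis by (simp only: indicator_simps if_False simp_thms)
    qed (simp only: indicator_simps \<open>x \<in> interior K\<close> if_True simp_thms)
    have "(\<Sum>L\<in>T. indicator (interior L) x * partial l (P L) x)
        = (\<Sum>L\<in>T. if L = K then partial l (P L) x else 0)" for l
      by (rule sum.cong) (simp_all add: ind)
    then have "(\<Sum>L\<in>T. indicator (interior L) x * partial l (P L) x) = partial l (P K) x" for l
      using that(1) fin by simp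
    then show ?thesis by (simp add: g_def classical_grad_def vec_eq_iff)
  qed
  have meas: "(\<lambda>x. g x $ l) \<in> borel_measurable borel" for l
    unfolding g_def vec_lambda_beta
    using cont_P
    by (intro borel_measurable_sum borel_measurable_times borel_measurable_indicator)
       (auto intro!: borel_measurable_continuous_onI)
  have "\<exists>M. \<forall>x\<in>cbox a b. \<bar>g x $ l\<bar> \<le> M" for l
  proof -
    have "\<exists>M. \<forall>x\<in>cbox a b. \<bar>partial l (P K) x\<bar> \<le> M" if "K \<in> T" for K
    proof -
      have "bounded (partial l (P K) ` cbox a b)"
        using continuous_on_subset[OF cont_P[OF that]]
        by (intro compact_imp_bounded compact_continuous_image) auto
      then show ?thesis by (auto simp: bounded_iff)
    qed
    then obtain M where M: "\<And>K x. K \<in> T \<Longrightarrow> x \<in> cbox a b \<Longrightarrow> \<bar>partial l (P K) x\<bar> \<le> M K"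
      by metis
    have "\<bar>g x $ l\<bar> \<le> (\<Sum>K\<in>T. M K)" if "x \<in> cbox a b" for x
    proof -
      have "\<bar>g x $ l\<bar> \<le> (\<Sum>K\<in>T. \<bar>indicator (interior K) x * partial l (P K) x\<bar>)"
        unfolding g_def vec_lambda_beta by (rule sum_abs)
      also have "\<dots> \<le> (\<Sum>K\<in>T. M K)"
      proof (rule sum_mono)
        fix K assume "K \<in> T"
        then show "\<bar>indicator (interior K) x * partial l (P K) x\<bar> \<le> M K"
          using M[of K x] that abs_ge_zero[of "partial l (P K) x"] by (auto simp: indicator_def)
      qed
      finally show ?thesis .
    qed
    then show ?thesis by blast
  qed
  then obtain M where M: "\<And>l x. x \<in> cbox a b \<Longrightarrow> \<bar>g x $ l\<bar> \<le> M l" by metis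
  have g_L2: "(\<lambda>x. g x $ l) \<in> L2 a b" for l
    using meas M[OF subsetD[OF box_subset_cbox]]
    by (intro L2_bounded[where M = "M l"] measurable_restrict_space1 measurable_completion) auto
  then have "g \<in> L2 a b" by (rule L2_from_components)
  have w_L2: "w \<in> L2 a b" using w_cont by (rule L2_continuous)
  have by_parts: "(LINT x|lebesgue_on (box a b). w x * partial l \<psi> x) = - (LINT x|lebesgue_on (box a b). g x $ l * \<psi> x)"
    if \<psi>: "\<psi> \<in> test_scalar a b" for \<psi> l
  proof -
    have \<psi>': "partial l \<psi> \<in> test_scalar a b" by (rule test_scalar_partial[OF \<psi>])
    define H where "H x = indicator (box a b) x * w x * partial l \<psi> x + g x $ l * \<psi> x" for x
    have "(\<lambda>x. indicator (box a b) x *\<^sub>R w x) \<in> borel_measurable borel"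
      using continuous_on_subset[OF w_cont box_subset_cbox]
      by (intro borel_measurable_continuous_on_indicator) auto
    then have H_meas: "H \<in> borel_measurable borel"
      unfolding H_def
        using meas borel_measurable_continuous_onI[OF test_scalar_continuous[OF \<psi>]]
          borel_measurable_continuous_onI[OF test_scalar_continuous[OF \<psi>']]
      by (simp add: borel_measurable_add borel_measurable_times)
    have "bounded ((\<lambda>x. w x * partial l \<psi> x) ` cbox a b)" "bounded (\<psi> ` cbox a b)"
      using w_cont test_scalar_continuous[OF \<psi>] test_scalar_continuous[OF \<psi>']
      by (intro compact_imp_bounded compact_continuous_image continuous_intros; simp)+
    then obtain A B where A: "\<And>x. x \<in> cbox a b \<Longrightarrow> \<bar>w x * partial l \<psi> x\<bar> \<le> A"
      and B: "\<And>x. x \<in> cbox a b \<Longrightarrow> \<bar>\<psi> x\<bar> \<le> B"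
      by (auto simp: bounded_iff)
    have "(LINT x|lebesgue_on (box a b). H x) = 0"
    proof (rule integral_axis_derivative_eq_0[OF box H_meas, where F = "\<lambda>x. w x * \<psi> x"
          and D = "mesh_coordinates T" and l = l and M = "A + M l * B"])
      fix x assume x: "x \<in> box a b"
      then have xc: "x \<in> cbox a b" using box_subset_cbox by blast
      have "\<bar>g x $ l * \<psi> x\<bar> \<le> M l * B"
        unfolding abs_mult using M[OF xc, of l] B[OF xc] by (intro mult_mono) auto
      then show "\<bar>H x\<bar> \<le> A + M l * B"
        using A[OF xc] x by (simp add: H_def)
      assume "\<forall>m. x $ m \<notin> mesh_coordinates T"
      then obtain K where K: "K \<in> T" "x \<in> interior K"
        using in_cell_interior[OF mesh xc] by blast
      have d: "(\<lambda>y. P K y * \<psi> y) differentiable at (x + 0 *\<^sub>R axis l 1)"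
        using diff_P[OF K(1)] test_scalar_differentiable[OF \<psi>] by (intro differentiable_mult)
      have wP: "w x = P K x" using w_eq[OF K(1)] K(2) interior_subset by blast
      have "partial l (\<lambda>y. P K y * \<psi> y) x = H x"
        using x K wP
        by (simp add: partial_mult diff_P test_scalar_differentiable[OF \<psi>] H_def g_eq[OF K] classical_grad_def)
      with has_real_derivative_along_axis[OF d]
      have D: "((\<lambda>t. P K (x + t *\<^sub>R axis l 1) * \<psi> (x + t *\<^sub>R axis l 1)) has_real_derivative H x) (at 0)"
        by simp
      have "open ((\<lambda>t. x + t *\<^sub>R axis l 1) -` interior K)"
        by (intro open_vimage continuous_intros) simp
      then show "((\<lambda>t. w (x + t *\<^sub>R axis l 1) * \<psi> (x + t *\<^sub>R axis l 1)) has_real_derivative H x) (at 0)"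
        by (rule has_field_derivative_transform_within_open[OF D])
           (use K w_eq[OF K(1) subsetD[OF interior_subset]] in auto)
    next
      show "continuous_on (cbox a b) (\<lambda>x. w x * \<psi> x)"
        by (intro continuous_intros w_cont test_scalar_continuous[OF \<psi>])
      show "finite (mesh_coordinates T)" by (rule finite_mesh_coordinates[OF mesh])
      fix x assume "x \<in> cbox a b" "x $ l = a $ l"
      then show "w (x + (b $ l - a $ l) *\<^sub>R axis l 1) * \<psi> (x + (b $ l - a $ l) *\<^sub>R axis l 1) = w x * \<psi> x"
        by (simp add: w_per test_scalar_periodic[OF \<psi>])
    qed
    also have "(LINT x|lebesgue_on (box a b). H x)
        = (LINT x|lebesgue_on (box a b). w x * partial l \<psi> x + g x $ l * \<psi> x)"
      by (rule Bochner_Integration.integral_cong) (simp_all add: H_def space_restrict_space)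
    also have "\<dots> = (LINT x|lebesgue_on (box a b). w x * partial l \<psi> x)
        + (LINT x|lebesgue_on (box a b). g x $ l * \<psi> x)"
      using L2_integrable_inner[OF w_L2 L2_test_scalar[OF \<psi>']] L2_integrable_inner[OF g_L2 L2_test_scalar[OF \<psi>]]
      by (intro Bochner_Integration.integral_add) auto
    finally show ?thesis by simp
  qed
  have "has_weak_grad a b w g"
    unfolding has_weak_grad_def
  proof (intro conjI ballI)
    show "g \<in> L2 a b" by fact
    fix \<psi> assume \<psi>: "\<psi> \<in> test_vector a b"
    note \<psi>l = test_vector_component[OF \<psi>]
    have i1: "integrable (lebesgue_on (box a b)) (\<lambda>x. w x * partial l (\<lambda>y. \<psi> y $ l) x)" for l
      using L2_integrable_inner[OF w_L2 L2_test_scalar[OF test_scalar_partial[OF \<psi>l]]] by simp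
    have i2: "integrable (lebesgue_on (box a b)) (\<lambda>x. g x $ l * \<psi> x $ l)" for l
      using L2_integrable_inner[OF g_L2 L2_test_scalar[OF \<psi>l]] by simp
    have "L2_inner a b w (classical_div \<psi>) = (\<Sum>l\<in>UNIV. LINT x|lebesgue_on (box a b). w x * partial l (\<lambda>y. \<psi> y $ l) x)"
      unfolding L2_inner_def classical_div_def inner_real_def sum_distrib_left
      by (rule Bochner_Integration.integral_sum) (rule i1)
    also have "\<dots> = - (\<Sum>l\<in>UNIV. LINT x|lebesgue_on (box a b). g x $ l * \<psi> x $ l)"
      by (simp add: by_parts[OF \<psi>l] sum_negf)
    also have "(\<Sum>l\<in>UNIV. LINT x|lebesgue_on (box a b). g x $ l * \<psi> x $ l) = L2_inner a b g \<psi>"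
      unfolding L2_inner_def inner_vec_def inner_real_def
      by (rule Bochner_Integration.integral_sum[symmetric]) (rule i2)
    finally show "L2_inner a b w (classical_div \<psi>) = - L2_inner a b g \<psi>" .
  qed
  with g_eq show thesis using that unfolding P_def[abs_def] by blast
qed

text \<open>
  The width that the chain rule puts into the denominator of a partial derivative is the one
  by which the covariant reference map multiplies that component, so the pulled-back gradient
  is the gradient of the reference polynomial.
\<close>

lemma grad_V_space:
  assumes box: "\<forall>l. a $ l < b $ l" and mesh: "conforming_mesh a b T"
    and w: "w \<in> V_space a b T k"
  shows "has_weak_grad a b w (grad a b w)" and "grad a b w \<in> E_space a b T k"
proof -
  have "\<forall>K\<in>T. \<exists>p\<in>Q_poly k k k. \<forall>x\<in>ref_cell. w (cell_map K x) = p x"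
    using w by (simp add: V_space_def)
  then obtain p where p: "\<And>K. K \<in> T \<Longrightarrow> p K \<in> Q_poly k k k"
      "\<And>K x. K \<in> T \<Longrightarrow> x \<in> ref_cell \<Longrightarrow> w (cell_map K x) = p K x"
    by metis
  obtain g where g: "has_weak_grad a b w g"
    "\<And>K x. K \<in> T \<Longrightarrow> x \<in> interior K \<Longrightarrow> g x = classical_grad (\<lambda>y. p K (cell_inv K y)) x"
    using V_space_weak_grad[OF box mesh w p] by blast
  show grad: "has_weak_grad a b w (grad a b w)" by (rule has_weak_grad_grad[OF g(1)])
  have ae: "AE x in lebesgue_on (box a b). grad a b w x = g x"
    by (rule has_weak_grad_unique_AE[OF box grad g(1)])
  have "\<exists>q\<in>Nedelec_poly k. AE x in lebesgue_on ref_cell.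
      transpose (cell_jacobian K) *v grad a b w (cell_map K x) = q x" if K: "K \<in> T" for K
  proof
    have Q: "p K \<in> Q_deg (\<lambda>_. k)" using p(1)[OF K] by (simp add: Q_deg_def)
    then show "classical_grad (p K) \<in> Nedelec_poly k"
      unfolding Nedelec_poly_iff classical_grad_def
      using Q_deg_differentiable_partial(2) by fastforce
    have "AE y in lebesgue_on (interior K). y \<in> interior K \<and> grad a b w y = g y"
      using ae interior_cell_subset_box[OF mesh K]
      by (auto simp: AE_restrict_space_iff borel_open elim!: eventually_mono)
    then have "AE x in lebesgue_on ref_cell. cell_map K x \<in> interior K \<and> grad a b w (cell_map K x) = g (cell_map K x)"
      by (rule AE_ref_cell_iff[OF mesh K, THEN iffD2])
    then show "AE x in lebesgue_on ref_cell.
      transpose (cell_jacobian K) *v grad a b w (cell_map K x) = classical_grad (p K) x"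
    proof eventually_elim
      case (elim x)
      then have "grad a b w (cell_map K x) $ l = partial l (p K) x / cell_width K $ l" for l
        using g(2)[OF K] partial_compose_cell_inv(2)[OF Q_deg_differentiable_partial(1)[OF Q]]
        by (simp add: classical_grad_def cell_map_cell_inv[OF mesh K])
      then show ?case
        using mesh_cell(4)[OF mesh K]
        by (simp add: vec_eq_iff matrix_vector_mult_def transpose_def cell_jacobian_def classical_grad_def
            if_distrib if_distribR less_imp_neq[symmetric] cong: if_cong)
    qed
  qed
  moreover have "grad a b w \<in> H_curl a b"
    using weak_grad_has_weak_curl_0[OF grad] grad by (auto simp: H_curl_def has_weak_grad_def)
  ultimately show "grad a b w \<in> E_space a b T k" by (simp add: E_space_def)
qed

section \<open>The curl of a Nedelec field is a Raviart--Thomas field\<close>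

lemma LINT_indicator_subbox:
  fixes f :: "real^3 \<Rightarrow> real"
  assumes "box u v \<subseteq> box a b"
  shows "(LINT x|lebesgue_on (box a b). indicator (box u v) x * f x) = (LINT x|lebesgue_on (box u v). f x)"
  using subsetD[OF assms]
  by (auto simp: integral_restrict_space indicator_def intro!: Bochner_Integration.integral_cong)

lemma inner_classical_curl_axis:
  fixes w :: "real^3"
  shows "w \<bullet> classical_curl (\<lambda>x. axis l (\<psi> x)) x
    = w $ (l + 1) * partial (l + 2) \<psi> x - w $ (l + 2) * partial (l + 1) \<psi> x"
proof -
  have ax: "(\<lambda>y. axis i (\<psi> y) $ m) = (if i = m then \<psi> else (\<lambda>y. 0))" for i m :: 3
    by (auto simp: axis_def)
  have "l = 1 \<or> l = 2 \<or> l = 3" by (rule exhaust_3)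
  then show ?thesis
    by (elim disjE; hypsubst; simp only: index_3_add inner_vec_def sum_3 classical_curl_component ax; simp)
qed

lemma partial_eq_0_outside:
  assumes zero: "\<forall>x\<in>cbox a b - box u v. \<psi> x = 0" and x: "x \<in> box a b" "x \<notin> cbox u v"
  shows "partial l \<psi> x = 0"
proof -
  have "open (box a b - cbox u v)" by (intro open_Diff open_box closed_cbox)
  moreover have "x \<in> box a b - cbox u v" using x by simp
  moreover have "0 = \<psi> y" if "y \<in> box a b - cbox u v" for y
  proof -
    have "y \<in> cbox a b - box u v"
      using that subsetD[OF box_subset_cbox, of y a b] subsetD[OF box_subset_cbox, of y u v] by blast
    then show ?thesis using zero by simp
  qed
  ultimately have "(\<psi> has_derivative (\<lambda>v. 0)) (at x)"
    by (rule has_derivative_transform_within_open[OF has_derivative_const])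
  then show ?thesis by (rule partial_eqI)
qed

text \<open>
  Where the field is smooth, the weak curl is the classical one: test functions that vanish off
  the subbox reduce the claim to integration by parts of \<open>C\<^sup>1\<close> functions without boundary terms.
\<close>

lemma weak_curl_eq_classical_on_subbox:
  assumes box: "\<forall>l. a $ l < b $ l"
    and sub: "\<And>l. a $ l \<le> u $ l" "\<And>l. u $ l < v $ l" "\<And>l. v $ l \<le> b $ l"
    and w: "w \<in> L2 a b" and c: "has_weak_curl a b w c"
    and e: "\<And>l. Ck 1 (\<lambda>x. e x $ l)"
    and w_e: "AE x in lebesgue_on (box u v). w x = e x"
  shows "AE x in lebesgue_on (box u v). c x = classical_curl e x"
proof -
  have uv_ab: "box u v \<subseteq> box a b"
    using sub by (auto simp: mem_box_cart) (meson less_le_trans le_less_trans)+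
  have cuv_ab: "cbox u v \<subseteq> cbox a b"
    using sub by (auto simp: mem_box_cart) (meson order.trans)+
  have uv: "\<forall>l. u $ l < v $ l" using sub by blast
  have ediff: "(\<lambda>x. e x $ l) differentiable at x" for l x using e[of l] by simp
  have econt: "continuous_on S (\<lambda>x. e x $ l)" for l S
    using Ck_Suc_imp_Ck[of 0 "\<lambda>x. e x $ l"] e[of l] continuous_on_subset by fastforce
  have pcont: "continuous_on S (partial m (\<lambda>x. e x $ l))" for l m S
    using e[of l] continuous_on_subset by fastforce
  let ?d = "classical_curl e"
  have dcont: "continuous_on S (\<lambda>x. ?d x $ l)" for l S
    unfolding classical_curl_component by (intro continuous_on_diff pcont)
  have c_L2: "c \<in> L2 a b" using c by (simp add: has_weak_curl_def)
  have ind: "(\<lambda>x. indicator (box u v) x * h x) \<in> L2 a b"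
    if h: "\<And>S. continuous_on S h" for h :: "real^3 \<Rightarrow> real"
  proof -
    have "h \<in> L2 a b" by (rule L2_continuous[OF h])
    then have m: "h \<in> borel_measurable (lebesgue_on (box a b))" by (simp add: L2_def)
    have "bounded (h ` cbox a b)"
      using h by (intro compact_imp_bounded compact_continuous_image) auto
    then obtain M where M: "\<And>x. x \<in> cbox a b \<Longrightarrow> \<bar>h x\<bar> \<le> M" by (auto simp: bounded_iff)
    have "\<bar>indicator (box u v) x * h x\<bar> \<le> \<bar>M\<bar>" if "x \<in> box a b" for x
      using M[OF subsetD[OF box_subset_cbox that]] by (auto simp: indicator_def)
    moreover have "(\<lambda>x. indicator (box u v) x * h x) \<in> borel_measurable (lebesgue_on (box a b))"
      using m uv_ab by (intro borel_measurable_times borel_measurable_indicator) (auto simp: sets_restrict_space_iff)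
    ultimately show ?thesis by (intro L2_bounded[where M = "\<bar>M\<bar>"]) auto
  qed
  define f where "f x = c x - (\<chi> l. indicator (box u v) x * ?d x $ l)" for x
  have f_L2: "f \<in> L2 a b"
    unfolding f_def by (intro L2_diff c_L2 L2_from_components) (simp add: ind dcont)
  have "AE x in lebesgue_on (box u v). f x = 0"
  proof (rule L2_orthogonal_test_vectors_on_subbox[OF box sub f_L2])
    fix \<psi> l assume \<psi>: "\<psi> \<in> test_scalar a b" and zero: "\<forall>x\<in>cbox a b - box u v. \<psi> x = 0"
    note \<psi>_L2 = L2_test_scalar[OF \<psi>]
    have \<psi>p: "partial m \<psi> \<in> test_scalar a b" for m by (rule test_scalar_partial[OF \<psi>])
    have \<psi>cont: "continuous_on S \<psi>" "continuous_on S (partial m \<psi>)" for S m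
      using test_scalar_continuous \<psi> \<psi>p by blast+
    have parts: "(LINT x|lebesgue_on (box u v). e x $ i * partial m \<psi> x)
        = - (LINT x|lebesgue_on (box u v). partial m (\<lambda>x. e x $ i) x * \<psi> x)" for i m
    proof -
      let ?H = "\<lambda>x. e x $ i * partial m \<psi> x + partial m (\<lambda>x. e x $ i) x * \<psi> x"
      have Hc: "continuous_on S ?H" for S by (intro continuous_intros econt pcont \<psi>cont)
      have "bounded (?H ` cbox u v)"
        using Hc by (intro compact_imp_bounded compact_continuous_image) auto
      then obtain M where M: "\<And>x. x \<in> cbox u v \<Longrightarrow> \<bar>?H x\<bar> \<le> M" by (auto simp: bounded_iff)
      have "(LINT x|lebesgue_on (box u v). ?H x) = 0"
      proof (rule integral_axis_derivative_eq_0[OF uv, where F = "\<lambda>x. e x $ i * \<psi> x" and D = "{}"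
            and M = M and l = m])
        show "?H \<in> borel_measurable borel" by (rule borel_measurable_continuous_onI[OF Hc])
        show "\<bar>?H x\<bar> \<le> M" if "x \<in> box u v" for x
          using M[OF subsetD[OF box_subset_cbox that]] .
        show "continuous_on (cbox u v) (\<lambda>x. e x $ i * \<psi> x)" by (intro continuous_intros econt \<psi>cont)
        show "((\<lambda>t. e (x + t *\<^sub>R axis m 1) $ i * \<psi> (x + t *\<^sub>R axis m 1)) has_real_derivative ?H x) (at 0)" for x
        proof -
          have "(\<lambda>x. e x $ i * \<psi> x) differentiable at (x + 0 *\<^sub>R axis m 1)"
            by (intro differentiable_mult ediff test_scalar_differentiable[OF \<psi>])
          from has_real_derivative_along_axis[OF this] show ?thesis
            by (simp add: partial_mult ediff test_scalar_differentiable[OF \<psi>])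
        qed
        fix x assume x: "x \<in> cbox u v" "x $ m = u $ m"
        let ?y = "x + (v $ m - u $ m) *\<^sub>R axis m 1"
        have y: "?y $ m = v $ m" "?y \<in> cbox u v"
          using x uv[rule_format, of m] mem_box_add_axis(1)[of x 0 m u v]
          by (simp_all add: mem_box_add_axis less_imp_le)
        have "x \<notin> box u v" "?y \<notin> box u v"
          using x(2) y(1) by (metis less_irrefl mem_box_cart(1))+
        then have "\<psi> x = 0" "\<psi> ?y = 0" using zero x(1) y(2) cuv_ab by blast+
        then show "e ?y $ i * \<psi> ?y = e x $ i * \<psi> x" by simp
      qed simp
      moreover have "integrable (lebesgue_on (box u v)) (\<lambda>x. e x $ i * partial m \<psi> x)"
        "integrable (lebesgue_on (box u v)) (\<lambda>x. partial m (\<lambda>x. e x $ i) x * \<psi> x)"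
        by (intro L2_integrable L2_continuous continuous_intros econt pcont \<psi>cont)+
      ultimately show ?thesis by simp
    qed
    have w_local: "(LINT x|lebesgue_on (box a b). w x $ i * partial m \<psi> x)
        = (LINT x|lebesgue_on (box u v). e x $ i * partial m \<psi> x)" for i m
    proof -
      have "AE x in lebesgue_on (box a b). x \<in> box u v \<longrightarrow> w x = e x"
        using w_e uv_ab by (auto simp: AE_restrict_space_iff elim!: eventually_mono)
      moreover have "AE x in lebesgue_on (box a b). x \<notin> cbox u v - box u v"
      proof -
        have "{x \<in> box a b. \<not> x \<notin> cbox u v - box u v} \<subseteq> cbox u v - box u v" by blast
        from negligible_subset[OF negligible_frontier_interval this]
        show ?thesis by (subst AE_lebesgue_on_iff_negligible) simp_all
      qed
      moreover have "AE x in lebesgue_on (box a b). x \<in> box a b" by (intro AE_I2) simp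
      ultimately have "AE x in lebesgue_on (box a b).
          w x $ i * partial m \<psi> x = indicator (box u v) x * (e x $ i * partial m \<psi> x)"
      proof eventually_elim
        case (elim x)
        show ?case
        proof (cases "x \<in> box u v")
          case False
          then have "x \<notin> cbox u v" using elim by blast
          then have "partial m \<psi> x = 0" using partial_eq_0_outside[OF zero] elim by blast
          with False show ?thesis by simp
        qed (use elim in simp)
      qed
      moreover have "(\<lambda>x. w x $ i * partial m \<psi> x) \<in> borel_measurable (lebesgue_on (box a b))"
        using L2_integrable_inner[OF L2_component[OF w] L2_test_scalar[OF \<psi>p]] borel_measurable_integrable
        by auto
      moreover have "(\<lambda>x. indicator (box u v) x * (e x $ i * partial m \<psi> x)) \<in> borel_measurable (lebesgue_on (box a b))"
        using ind[OF continuous_on_mult[OF econt \<psi>cont(2)]] by (simp add: L2_def)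
      ultimately have "(LINT x|lebesgue_on (box a b). w x $ i * partial m \<psi> x)
          = (LINT x|lebesgue_on (box a b). indicator (box u v) x * (e x $ i * partial m \<psi> x))"
        by (intro integral_cong_AE)
      then show ?thesis by (simp add: LINT_indicator_subbox[OF uv_ab])
    qed
    have int_w: "integrable (lebesgue_on (box a b)) (\<lambda>x. w x $ i * partial m \<psi> x)" for i m
      using L2_integrable_inner[OF L2_component[OF w] L2_test_scalar[OF \<psi>p]] by simp
    have "(LINT x|lebesgue_on (box a b). c x $ l * \<psi> x) = L2_inner a b c (\<lambda>x. axis l (\<psi> x))"
      by (simp add: L2_inner_axis_right)
    also have "\<dots> = L2_inner a b w (classical_curl (\<lambda>x. axis l (\<psi> x)))"
      using c test_vector_axis[OF \<psi>] by (simp add: has_weak_curl_def)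
    also have "\<dots> = (LINT x|lebesgue_on (box a b). w x $ (l + 1) * partial (l + 2) \<psi> x)
        - (LINT x|lebesgue_on (box a b). w x $ (l + 2) * partial (l + 1) \<psi> x)"
      unfolding L2_inner_def inner_classical_curl_axis
      by (rule Bochner_Integration.integral_diff[OF int_w int_w])
    also have "\<dots> = (LINT x|lebesgue_on (box u v). partial (l + 1) (\<lambda>x. e x $ (l + 2)) x * \<psi> x)
        - (LINT x|lebesgue_on (box u v). partial (l + 2) (\<lambda>x. e x $ (l + 1)) x * \<psi> x)"
      unfolding w_local parts by simp
    also have "\<dots> = (LINT x|lebesgue_on (box u v). partial (l + 1) (\<lambda>x. e x $ (l + 2)) x * \<psi> x
        - partial (l + 2) (\<lambda>x. e x $ (l + 1)) x * \<psi> x)"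
      by (rule Bochner_Integration.integral_diff[symmetric];
          intro L2_integrable L2_continuous continuous_intros pcont \<psi>cont)
    also have "\<dots> = (LINT x|lebesgue_on (box u v). ?d x $ l * \<psi> x)"
      by (simp add: classical_curl_component left_diff_distrib)
    also have "\<dots> = (LINT x|lebesgue_on (box a b). indicator (box u v) x * (?d x $ l * \<psi> x))"
      by (simp add: LINT_indicator_subbox[OF uv_ab])
    finally have eq: "(LINT x|lebesgue_on (box a b). c x $ l * \<psi> x)
        = (LINT x|lebesgue_on (box a b). indicator (box u v) x * (?d x $ l * \<psi> x))" .
    have "(LINT x|lebesgue_on (box a b). f x $ l * \<psi> x)
        = (LINT x|lebesgue_on (box a b). c x $ l * \<psi> x - indicator (box u v) x * (?d x $ l * \<psi> x))"
      by (simp add: f_def left_diff_distrib mult.assoc)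
    also have "\<dots> = (LINT x|lebesgue_on (box a b). c x $ l * \<psi> x)
        - (LINT x|lebesgue_on (box a b). indicator (box u v) x * (?d x $ l * \<psi> x))"
    proof (rule Bochner_Integration.integral_diff)
      show "integrable (lebesgue_on (box a b)) (\<lambda>x. c x $ l * \<psi> x)"
        using L2_integrable_inner[OF L2_component[OF c_L2] \<psi>_L2] by simp
      show "integrable (lebesgue_on (box a b)) (\<lambda>x. indicator (box u v) x * (?d x $ l * \<psi> x))"
        by (rule L2_integrable, rule ind, intro continuous_intros dcont \<psi>cont)
    qed
    finally show "(LINT x|lebesgue_on (box a b). f x $ l * \<psi> x) = 0" using eq by simp
  qed
  moreover have "AE x in lebesgue_on (box u v). x \<in> box u v" by (intro AE_I2) simp
  ultimately show ?thesis
    by eventually_elim (simp add: f_def vec_eq_iff)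
qed

lemma matrix_inv_eqI:
  fixes A :: "real^3^3"
  assumes "A ** B = mat 1" "B ** A = mat 1"
  shows "matrix_inv A = B"
proof -
  have "A ** matrix_inv A = mat 1 \<and> matrix_inv A ** A = mat 1"
    unfolding matrix_inv_def by (rule someI[of _ B]) (use assms in simp)
  then have "matrix_inv A = matrix_inv A ** (A ** B)" "matrix_inv A ** A = mat 1"
    using assms by (simp_all add: matrix_mul_rid)
  then show ?thesis by (simp add: matrix_mul_assoc matrix_mul_lid)
qed

text \<open>
  The factor is the area of the cell face orthogonal to direction \<open>l\<close>. In component \<open>l\<close> of a
  curl it cancels one width from the covariant pullback of the field and one from the chain
  rule.
\<close>

lemma contravariant_cell_map_component:
  assumes "conforming_mesh a b T" "K \<in> T"
  shows "(det (cell_jacobian K) *\<^sub>R (matrix_inv (cell_jacobian K) *v w)) $ l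
    = cell_width K $ (l + 1) * cell_width K $ (l + 2) * w $ l"
proof -
  have pos: "cell_width K $ i \<noteq> 0" for i using mesh_cell(4)[OF assms, of i] by simp
  have "det (cell_jacobian K) = (\<Prod>i\<in>UNIV. cell_jacobian K $ i $ i)"
    by (rule det_diagonal) (simp add: cell_jacobian_def)
  also have "\<dots> = (\<Prod>i\<in>{1, 2, 3}. cell_width K $ i)"
    by (simp only: UNIV_3[symmetric]) (simp add: cell_jacobian_def)
  finally have det: "det (cell_jacobian K) = cell_width K $ 1 * cell_width K $ 2 * cell_width K $ 3"
    by simp
  have inv: "matrix_inv (cell_jacobian K) = (\<chi> i j. if i = j then 1 / cell_width K $ i else 0)"
    by (rule matrix_inv_eqI; unfold vec_eq_iff matrix_matrix_mult_def cell_jacobian_def mat_def;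
        simp add: if_distrib[where f = "\<lambda>x. x * c" for c] pos cong: if_cong)
  have "(matrix_inv (cell_jacobian K) *v w) $ l = w $ l / cell_width K $ l"
    unfolding inv by (simp add: matrix_vector_mult_def if_distrib if_distribR cong: if_cong)
  moreover have "l = 1 \<or> l = 2 \<or> l = 3" by (rule exhaust_3)
  then have "det (cell_jacobian K) = cell_width K $ l * cell_width K $ (l + 1) * cell_width K $ (l + 2)"
    unfolding det by (elim disjE; hypsubst; simp only: index_3_add; simp)
  ultimately show ?thesis using pos[of l] by simp
qed

text \<open>
  The scalings of the two reference maps cancel in the curl, so on the reference cell the weak
  curl becomes the curl of the reference polynomial.
\<close>

lemma curl_E_space:
  assumes box: "\<forall>l. a $ l < b $ l" and mesh: "conforming_mesh a b T"
    and w: "w \<in> E_space a b T k"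
  shows "has_weak_curl a b w (curl a b w)" and "curl a b w \<in> B_space a b T k"
proof -
  have w_L2: "w \<in> L2 a b" using w by (simp add: E_space_def H_curl_def)
  show c: "has_weak_curl a b w (curl a b w)"
    using w has_weak_curl_curl by (auto simp: E_space_def H_curl_def)
  have "\<exists>q\<in>RT_poly k. AE x in lebesgue_on ref_cell.
       det (cell_jacobian K) *\<^sub>R (matrix_inv (cell_jacobian K) *v curl a b w (cell_map K x)) = q x"
    if K: "K \<in> T" for K
  proof -
    obtain p where p: "p \<in> Nedelec_poly k"
      and wp: "AE x in lebesgue_on ref_cell. transpose (cell_jacobian K) *v w (cell_map K x) = p x"
      using w K by (auto simp: E_space_def)
    note pos = mesh_cell(4)[OF mesh K]
    have Q: "(\<lambda>x. p x $ l) \<in> Q_deg ((\<lambda>m. k)(l := k - 1))" for l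
      using p by (simp add: Nedelec_poly_iff)
    note pdiff = Q_deg_differentiable_partial(1)[OF Q]
    define e :: "real^3 \<Rightarrow> real^3" where "e y = (\<chi> l. 1 / cell_width K $ l * p (cell_inv K y) $ l)" for y
    have e_partial: "partial m (\<lambda>y. e y $ l) y
        = partial m (\<lambda>x. p x $ l) (cell_inv K y) / (cell_width K $ m * cell_width K $ l)" for m l y
      unfolding e_def vec_lambda_beta
      using partial_cmult[OF partial_compose_cell_inv(1)[OF pdiff[of l], where K = K and y = y],
          where l = m and c = "1 / cell_width K $ l"]
        partial_compose_cell_inv(2)[OF pdiff[of l], where K = K and l = m and y = y]
      by simp
    have e_Ck: "Ck 1 (\<lambda>y. e y $ l)" for l
    proof -
      have "(\<lambda>y. e y $ l) differentiable at y" for y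
        unfolding e_def vec_lambda_beta
        by (intro differentiable_mult differentiable_const partial_compose_cell_inv(1)[OF pdiff])
      moreover have "continuous_on UNIV (partial m (\<lambda>y. e y $ l))" for m
      proof -
        have "continuous_on UNIV (partial m (\<lambda>x. p x $ l))"
          using Q_deg_Ck[OF Q, of 1] by simp
        then have "continuous_on UNIV (\<lambda>y. partial m (\<lambda>x. p x $ l) (cell_inv K y))"
          using continuous_on_cell_inv by (rule continuous_on_compose2) auto
        then have "continuous_on UNIV (\<lambda>y. partial m (\<lambda>x. p x $ l) (cell_inv K y) / (cell_width K $ m * cell_width K $ l))"
          using pos[of m] pos[of l] by (intro continuous_on_divide) auto
        then show ?thesis by (simp add: e_partial[abs_def])
      qed
      ultimately show ?thesis by simp
    qed
    have "AE x in lebesgue_on ref_cell. w (cell_map K x) = e (cell_map K x)"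
      using wp
    proof eventually_elim
      case (elim x)
      have "(transpose (cell_jacobian K) *v w (cell_map K x)) $ l = cell_width K $ l * w (cell_map K x) $ l" for l
        by (simp add: matrix_vector_mult_def transpose_def cell_jacobian_def if_distrib if_distribR cong: if_cong)
      then have "p x $ l = cell_width K $ l * w (cell_map K x) $ l" for l
        unfolding elim by simp
      then show ?case
        using pos by (simp add: e_def vec_eq_iff cell_map_cell_inv[OF mesh K] less_imp_neq[symmetric])
    qed
    then have "AE y in lebesgue_on (interior K). w y = e y"
      by (rule AE_ref_cell_iff[OF mesh K, THEN iffD1])
    then have "AE y in lebesgue_on (interior K). curl a b w y = classical_curl e y"
      unfolding mesh_cell(2)[OF mesh K]
      by (intro weak_curl_eq_classical_on_subbox[OF box _ _ _ w_L2 c e_Ck] mesh_cell[OF mesh K])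
    then have AE: "AE x in lebesgue_on ref_cell. curl a b w (cell_map K x) = classical_curl e (cell_map K x)"
      by (rule AE_ref_cell_iff[OF mesh K, THEN iffD2])
    show ?thesis
    proof
      show "classical_curl p \<in> RT_poly k"
        unfolding RT_poly_iff classical_curl_component by (intro allI curl_Nedelec_component[OF p])
      show "AE x in lebesgue_on ref_cell.
          det (cell_jacobian K) *\<^sub>R (matrix_inv (cell_jacobian K) *v curl a b w (cell_map K x)) = classical_curl p x"
        using AE
      proof eventually_elim
        case (elim x)
        have "(det (cell_jacobian K) *\<^sub>R (matrix_inv (cell_jacobian K) *v curl a b w (cell_map K x))) $ l
            = classical_curl p x $ l" for l
          unfolding contravariant_cell_map_component[OF mesh K] elim
          using pos[of "l + 1"] pos[of "l + 2"]
          by (simp add: classical_curl_component e_partial cell_map_cell_inv[OF mesh K] field_simps)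
        then show ?case by (simp only: vec_eq_iff) simp
      qed
    qed
  qed
  moreover have "curl a b w \<in> H_div a b"
    using weak_curl_has_weak_div_0[OF c] c by (auto simp: H_div_def has_weak_curl_def)
  ultimately show "curl a b w \<in> B_space a b T k" by (simp add: B_space_def)
qed

section \<open>The discrete Gauss laws\<close>

lemma has_weak_div_add:
  assumes "v \<in> L2 a b" "w \<in> L2 a b" "has_weak_div a b v d" "has_weak_div a b w d'"
  shows "has_weak_div a b (\<lambda>x. v x + w x) (\<lambda>x. d x + d' x)"
  using assms
  by (simp add: has_weak_div_def L2_add L2_inner_add_left L2_test_scalar L2_test_vector
      classical_grad_test_vector)

lemma has_weak_div_scaleR:
  assumes "has_weak_div a b v d"
  shows "has_weak_div a b (\<lambda>x. r *\<^sub>R v x) (\<lambda>x. r *\<^sub>R d x)"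
  using assms L2_scaleR[of d a b r] L2_inner_scaleR_left[of a b r v] L2_inner_scaleR_left[of a b r d]
  unfolding has_weak_div_def by simp

lemma B_space_L2: "w \<in> B_space a b T k \<Longrightarrow> w \<in> L2 a b"
  by (simp add: B_space_def H_div_def)

lemma B_space_add:
  assumes v: "v \<in> B_space a b T k" and w: "w \<in> B_space a b T k"
  shows "(\<lambda>x. v x + w x) \<in> B_space a b T k"
proof -
  have "(\<lambda>x. v x + w x) \<in> H_div a b"
    using v w L2_add has_weak_div_add unfolding B_space_def H_div_def by blast
  moreover have "\<exists>p\<in>RT_poly k. AE x in lebesgue_on ref_cell.
       det (cell_jacobian K) *\<^sub>R (matrix_inv (cell_jacobian K) *v (v (cell_map K x) + w (cell_map K x))) = p x"
    if K: "K \<in> T" for K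
  proof -
    obtain p where p: "p \<in> RT_poly k" "AE x in lebesgue_on ref_cell.
        det (cell_jacobian K) *\<^sub>R (matrix_inv (cell_jacobian K) *v v (cell_map K x)) = p x"
      using v K by (auto simp: B_space_def)
    obtain q where q: "q \<in> RT_poly k" "AE x in lebesgue_on ref_cell.
        det (cell_jacobian K) *\<^sub>R (matrix_inv (cell_jacobian K) *v w (cell_map K x)) = q x"
      using w K by (auto simp: B_space_def)
    have "(\<lambda>x. p x + q x) \<in> RT_poly k"
      using p(1) q(1) by (simp add: RT_poly_def Q_poly_add)
    moreover have "AE x in lebesgue_on ref_cell.
       det (cell_jacobian K) *\<^sub>R (matrix_inv (cell_jacobian K) *v (v (cell_map K x) + w (cell_map K x))) = p x + q x"
      using p(2) q(2)
      by eventually_elim (simp add: matrix_vector_right_distrib scaleR_right_distrib)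
    ultimately show ?thesis by (intro bexI[where x = "\<lambda>x. p x + q x"])
  qed
  ultimately show ?thesis by (simp add: B_space_def)
qed

lemma B_space_scaleR:
  assumes v: "v \<in> B_space a b T k"
  shows "(\<lambda>x. r *\<^sub>R v x) \<in> B_space a b T k"
proof -
  have "(\<lambda>x. r *\<^sub>R v x) \<in> H_div a b"
    using v L2_scaleR has_weak_div_scaleR unfolding B_space_def H_div_def by blast
  moreover have "\<exists>p\<in>RT_poly k. AE x in lebesgue_on ref_cell.
       det (cell_jacobian K) *\<^sub>R (matrix_inv (cell_jacobian K) *v (r *\<^sub>R v (cell_map K x))) = p x"
    if K: "K \<in> T" for K
  proof -
    obtain p where p: "p \<in> RT_poly k" "AE x in lebesgue_on ref_cell.
        det (cell_jacobian K) *\<^sub>R (matrix_inv (cell_jacobian K) *v v (cell_map K x)) = p x"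
      using v K by (auto simp: B_space_def)
    have "(\<lambda>x. r *\<^sub>R p x) \<in> RT_poly k"
      using p(1) by (simp add: RT_poly_def Q_poly_cmult)
    moreover have "AE x in lebesgue_on ref_cell.
       det (cell_jacobian K) *\<^sub>R (matrix_inv (cell_jacobian K) *v (r *\<^sub>R v (cell_map K x))) = r *\<^sub>R p x"
      using p(2)
    proof eventually_elim
      case (elim x)
      show ?case
        unfolding elim[symmetric] by (simp add: matrix_vector_mult_scaleR)
    qed
    ultimately show ?thesis by (intro bexI[where x = "\<lambda>x. r *\<^sub>R p x"])
  qed
  ultimately show ?thesis by (simp add: B_space_def)
qed

text \<open>
  The residual of the update, the difference quotient plus the curl, belongs to the space of
  test functions. Being orthogonal to that space, it is orthogonal to itself.
\<close>

lemma magnetic_update_AE: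
  assumes box: "\<forall>l. a $ l < b $ l" and mesh: "conforming_mesh a b T"
    and E: "E \<in> E_space a b T k" and B: "B \<in> B_space a b T k" and B': "B' \<in> B_space a b T k"
    and scheme: "\<forall>\<xi>\<in>B_space a b T k.
          L2_inner a b (\<lambda>x. (B' x - B x) /\<^sub>R t) \<xi> = L2_inner a b (\<lambda>x. - curl a b E x) \<xi>"
  shows "AE x in lebesgue_on (box a b). (B' x - B x) /\<^sub>R t = - curl a b E x"
proof -
  note cB = curl_E_space(2)[OF box mesh E]
  define \<delta> where "\<delta> x = (B' x - B x) /\<^sub>R t" for x
  have \<delta>: "\<delta> \<in> B_space a b T k"
    using B_space_scaleR[OF B_space_add[OF B' B_space_scaleR[OF B, of "-1"]], of "inverse t"]
    by (simp add: \<delta>_def[abs_def])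
  have \<xi>: "(\<lambda>x. \<delta> x + curl a b E x) \<in> B_space a b T k" by (rule B_space_add[OF \<delta> cB])
  have "L2_inner a b \<delta> (\<lambda>x. \<delta> x + curl a b E x)
      = - L2_inner a b (curl a b E) (\<lambda>x. \<delta> x + curl a b E x)"
    using scheme \<xi> by (simp add: \<delta>_def[abs_def] L2_inner_uminus_left)
  then have "L2_inner a b (\<lambda>x. \<delta> x + curl a b E x) (\<lambda>x. \<delta> x + curl a b E x) = 0"
    unfolding L2_inner_add_left[OF B_space_L2[OF \<delta>] B_space_L2[OF cB] B_space_L2[OF \<xi>]] by simp
  from L2_inner_self_eq_0[OF B_space_L2[OF \<xi>] this]
  show ?thesis
    by eventually_elim (simp add: \<delta>_def eq_neg_iff_add_eq_0)
qed

text \<open>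
  The update subtracts a multiple of a weak curl, which is orthogonal to all gradients of test
  functions. Both fields therefore have the same set of weak divergences, and the choice in
  \<open>diverg\<close> depends on nothing else; this gives an equation of functions, not only one almost
  everywhere.
\<close>

lemma diverg_magnetic_update:
  assumes box: "\<forall>l. a $ l < b $ l" and mesh: "conforming_mesh a b T"
    and E: "E \<in> E_space a b T k" and B: "B \<in> B_space a b T k" and B': "B' \<in> B_space a b T k"
    and t: "t > 0"
    and scheme: "\<forall>\<xi>\<in>B_space a b T k.
          L2_inner a b (\<lambda>x. (B' x - B x) /\<^sub>R t) \<xi> = L2_inner a b (\<lambda>x. - curl a b E x) \<xi>"
  shows "diverg a b B' = diverg a b B"
proof -
  note c = curl_E_space[OF box mesh E]
  have "L2_inner a b B' (classical_grad \<psi>) = L2_inner a b B (classical_grad \<psi>)"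
    if \<psi>: "\<psi> \<in> test_scalar a b" for \<psi>
  proof -
    note g = L2_test_vector[OF classical_grad_test_vector[OF \<psi>]]
    note L = B_space_L2[OF B] B_space_L2[OF B'] B_space_L2[OF c(2)]
    have m: "w \<in> L2 a b \<Longrightarrow> (\<lambda>x. w x \<bullet> classical_grad \<psi> x) \<in> borel_measurable (lebesgue_on (box a b))"
      for w :: "real^3 \<Rightarrow> real^3"
      using L2_integrable_inner[OF _ g] borel_measurable_integrable by blast
    have "AE x in lebesgue_on (box a b). B' x = B x - t *\<^sub>R curl a b E x"
      using magnetic_update_AE[OF box mesh E B B' scheme]
    proof eventually_elim
      case (elim x)
      have "B' x - B x = t *\<^sub>R ((B' x - B x) /\<^sub>R t)" using t by simp
      then show ?case unfolding elim by (simp add: algebra_simps)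
    qed
    then have "L2_inner a b B' (classical_grad \<psi>)
        = L2_inner a b (\<lambda>x. B x - t *\<^sub>R curl a b E x) (classical_grad \<psi>)"
      unfolding L2_inner_def
      by (intro integral_cong_AE m L2_diff L2_scaleR L) (auto elim!: eventually_mono)
    also have "\<dots> = L2_inner a b B (classical_grad \<psi>) - t * L2_inner a b (curl a b E) (classical_grad \<psi>)"
      by (simp add: L2_inner_diff_left L2_scaleR L g L2_inner_scaleR_left)
    also have "L2_inner a b (curl a b E) (classical_grad \<psi>) = 0"
      by (rule weak_curl_orthogonal_grad[OF c(1) \<psi>])
    finally show ?thesis by simp
  qed
  then have "has_weak_div a b B' = has_weak_div a b B"
    by (simp add: fun_eq_iff has_weak_div_def)
  then show ?thesis by (simp add: diverg_def)
qed

theorem proposition5: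
  fixes a b :: "real^3"
    and T :: "(real^3) set set"
    and k :: nat
    and I :: "'i set"
    and \<phi> :: "'i \<Rightarrow> real^3 \<Rightarrow> real"
    and \<epsilon>0 \<mu>0 c :: real
    and \<tau> :: "nat \<Rightarrow> real"
    and \<rho> :: "nat \<Rightarrow> real^3 \<Rightarrow> real"
    and J :: "nat \<Rightarrow> real^3 \<Rightarrow> real^3"
    and A :: "nat \<Rightarrow> real^3 \<Rightarrow> real^3^3"
    and E B :: "nat \<Rightarrow> real^3 \<Rightarrow> real^3"
  assumes box: "\<forall>l. a $ l < b $ l"
    and mesh: "conforming_mesh a b T"
    and k: "k \<ge> 1"
    and basis: "lagrange_basis a b T k I \<phi>"
    and params: "\<epsilon>0 > 0" "\<mu>0 > 0" "c = 1 / sqrt (\<epsilon>0 * \<mu>0)"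
    and steps: "\<forall>n. \<tau> n > 0"
    and rho: "\<forall>n. \<rho> n \<in> V_space a b T k"
    and current: "\<forall>n l. (\<lambda>x. J n x $ l) \<in> V_space a b T k"
    and viscosity_offdiag: "\<forall>n i j. \<forall>x\<in>cbox a b. i \<noteq> j \<longrightarrow> A n x $ i $ j = 0"
    and viscosity_diag: "\<forall>n l. (\<lambda>x. A n x $ l $ l) \<in> V_space a b T k"
    and E_in: "\<forall>n. E n \<in> E_space a b T k"
    and B_in: "\<forall>n. B n \<in> B_space a b T k"
    and gauss_E0: "\<forall>i\<in>I. L2_inner a b (E 0) (grad a b (\<phi> i))
                        = - L2_inner a b (\<lambda>x. inverse \<epsilon>0 * \<rho> 0 x) (\<phi> i)"
    and gauss_B0: "AE x in lebesgue_on (box a b). diverg a b (B 0) x = 0"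
    and continuity: "\<forall>n. \<forall>i\<in>I.
          div_pairing a b (\<lambda>x. J n x - A n x *v grad a b (\<rho> n) x) (\<phi> i)
            = - L2_inner a b (\<lambda>x. (\<rho> (Suc n) x - \<rho> n x) / \<tau> n) (\<phi> i)"
    and scheme_E: "\<forall>n. \<forall>\<eta>\<in>E_space a b T k.
          L2_inner a b (\<lambda>x. (E (Suc n) x - E n x) /\<^sub>R \<tau> n) \<eta>
            = L2_inner a b (\<lambda>x. c\<^sup>2 *\<^sub>R B n x) (curl a b \<eta>)
              - L2_inner a b (\<lambda>x. inverse \<epsilon>0 *\<^sub>R (J n x - A n x *v grad a b (\<rho> n) x)) \<eta>"
    and scheme_B: "\<forall>n. \<forall>\<xi>\<in>B_space a b T k.
          L2_inner a b (\<lambda>x. (B (Suc n) x - B n x) /\<^sub>R \<tau> n) \<xi>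
            = L2_inner a b (\<lambda>x. - curl a b (E n) x) \<xi>"
  shows "\<forall>n. (\<forall>i\<in>I.
            L2_inner a b (\<lambda>x. (E (Suc n) x - E n x) /\<^sub>R \<tau> n) (grad a b (\<phi> i))
              = - L2_inner a b (\<lambda>x. inverse \<epsilon>0 * ((\<rho> (Suc n) x - \<rho> n x) / \<tau> n)) (\<phi> i))
          \<and> (AE x in lebesgue_on (box a b). diverg a b (B (Suc n)) x = 0)"
proof (intro allI conjI ballI)
  fix n i assume i: "i \<in> I"
  have \<phi>: "\<phi> i \<in> V_space a b T k"
    using basis i by (auto simp: lagrange_basis_def)
  note g = grad_V_space[OF box mesh \<phi>]
  let ?G = "\<lambda>x. J n x - A n x *v grad a b (\<rho> n) x"
  have "L2_inner a b (\<lambda>x. (E (Suc n) x - E n x) /\<^sub>R \<tau> n) (grad a b (\<phi> i))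
      = L2_inner a b (\<lambda>x. c\<^sup>2 *\<^sub>R B n x) (curl a b (grad a b (\<phi> i)))
        - L2_inner a b (\<lambda>x. inverse \<epsilon>0 *\<^sub>R ?G x) (grad a b (\<phi> i))"
    using scheme_E g(2) by blast
  also have "L2_inner a b (\<lambda>x. c\<^sup>2 *\<^sub>R B n x) (curl a b (grad a b (\<phi> i))) = 0"
    by (rule L2_inner_eq_0_AE[OF curl_grad_AE_0[OF box g(1)]])
  also have "L2_inner a b (\<lambda>x. inverse \<epsilon>0 *\<^sub>R ?G x) (grad a b (\<phi> i))
      = inverse \<epsilon>0 * L2_inner a b ?G (grad a b (\<phi> i))"
    by (rule L2_inner_scaleR_left)
  also have "L2_inner a b ?G (grad a b (\<phi> i))
      = L2_inner a b (\<lambda>x. (\<rho> (Suc n) x - \<rho> n x) / \<tau> n) (\<phi> i)"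
    using continuity[rule_format, OF i, of n] by (simp add: div_pairing_def)
  also have "inverse \<epsilon>0 * \<dots> = L2_inner a b (\<lambda>x. inverse \<epsilon>0 * ((\<rho> (Suc n) x - \<rho> n x) / \<tau> n)) (\<phi> i)"
    unfolding real_scaleR_def[symmetric] by (subst L2_inner_scaleR_left) simp
  finally show "L2_inner a b (\<lambda>x. (E (Suc n) x - E n x) /\<^sub>R \<tau> n) (grad a b (\<phi> i))
      = - L2_inner a b (\<lambda>x. inverse \<epsilon>0 * ((\<rho> (Suc n) x - \<rho> n x) / \<tau> n)) (\<phi> i)"
    by simp
next
  have step: "diverg a b (B (Suc n)) = diverg a b (B n)" for n
    by (rule diverg_magnetic_update[OF box mesh, of "E n" k _ _ "\<tau> n"])
       (use E_in B_in steps scheme_B in blast)+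
  have const: "diverg a b (B n) = diverg a b (B 0)" for n
    by (induction n) (simp_all add: step)
  show "AE x in lebesgue_on (box a b). diverg a b (B (Suc n)) x = 0" for n
    unfolding const[of "Suc n"] by (rule gauss_B0)
qed

end
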